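(* Let $n\geq 3$. Suppose $G_1,\dots,G_s$ are pairwise disjoint admissible domains in $\mathbb{R}^n$. Then $s\leq e(n+1)^2$. Equivalently, $s(n)\leq e(n+1)^2$, where $s(n)$ denotes the maximal cardinality of a collection of pairwise disjoint admissible domains in $\mathbb{R}^n$.
   Context: A domain $G\subset\mathbb{R}^n$ (connected open set) is called admissible if there is a function $w\in C^2(G)\cap C(\overline{G})$, not identically zero, solving the minimal surface equation $\operatorname{div}\big(\nabla w/\sqrt{1+|\nabla w|^2}\big)=0$ in $G$, such that $w$ does not change sign in $G$ and $w=0$ on $\partial G$. The graph $x_{n+1}=w(x)$, $x\in G$, is then called a minimal graph supported on $G$. *)

theory Defs
  imports "HOL-Analysis.Analysis"
begin

definition partial :: "(real^'n \<Rightarrow> real) \<Rightarrow> 'n \<Rightarrow> real^'n \<Rightarrow> real" where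
  "partial f i x = frechet_derivative f (at x) (axis i 1)"

definition grad :: "(real^'n \<Rightarrow> real) \<Rightarrow> real^'n \<Rightarrow> real^'n" where
  "grad f x = (\<chi> i. partial f i x)"

definition C2_on :: "(real^'n) set \<Rightarrow> (real^'n \<Rightarrow> real) \<Rightarrow> bool" where
  "C2_on G w \<longleftrightarrow>
     (\<forall>x\<in>G. w differentiable (at x)) \<and>
     (\<forall>i. \<forall>x\<in>G. partial w i differentiable (at x)) \<and>
     (\<forall>i j. continuous_on G (partial (partial w i) j))"

definition minimal_surface_eq_on :: "(real^'n) set \<Rightarrow> (real^'n \<Rightarrow> real) \<Rightarrow> bool" where
  "minimal_surface_eq_on G w \<longleftrightarrow>
     (\<forall>x\<in>G. (\<Sum>i\<in>UNIV. partial (\<lambda>y. grad w y $ i / sqrt (1 + (norm (grad w y))\<^sup>2)) i x) = 0)"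

definition admissible :: "(real^'n) set \<Rightarrow> bool" where
  "admissible G \<longleftrightarrow> open G \<and> connected G \<and>
     (\<exists>w. C2_on G w \<and> continuous_on (closure G) w \<and>
          (\<exists>x\<in>G. w x \<noteq> 0) \<and>
          minimal_surface_eq_on G w \<and>
          ((\<forall>x\<in>G. w x \<ge> 0) \<or> (\<forall>x\<in>G. w x \<le> 0)) \<and>
          (\<forall>x\<in>frontier G. w x = 0))"

end

theory Submission
  imports Defs
begin

text \<open>
  Let \<open>w \<ge> 0\<close> solve the minimal surface equation on \<open>G\<close> and vanish on its boundary, and put
  \<open>W = sqrt (1 + |grad w|^2)\<close>. The height \<open>w\<close> is harmonic on the graph, so a truncation \<open>F(w)\<close>
  with \<open>F\<close> convex is subharmonic, also across the boundary, and the monotonicity formula gives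
  \<open>F(w(x)) \<omega>\<^sub>n r^n \<le> M(R + r)\<close>, where \<open>M(R)\<close> is the integral of \<open>F(w)\<close> over the part of the graph in
  the cylinder \<open>|x| \<le> R, w \<le> R\<close> and \<open>x\<close> lies in that part. Integrating over this part, of area
  \<open>A(R)\<close>, gives \<open>M(R) \<omega>\<^sub>n r^n \<le> M(R + r) A(R)\<close>.

  Comparison with the boundary of the cylinder shows that the areas \<open>A\<^sub>k(R)\<close> of disjoint graphs add
  up to at most \<open>(n + 1) \<omega>\<^sub>n R^n\<close>. With \<open>r = n R\<close> this means
  \<open>\<Sum>\<^sub>k M\<^sub>k(R) / M\<^sub>k((n + 1) R) \<le> (n + 1) / n^n\<close>, whereas \<open>M\<^sub>k(R) = O(R^(n + 1))\<close>.
  AM-GM along the radii \<open>(n + 1)^m R\<close> yields \<open>s \<le> (n + 1)^(n + 2) / n^n \<le> e (n + 1)^2\<close>.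
\<close>

section \<open>Integrals of divergences\<close>

text \<open>The domains may be unbounded and their boundaries have no regularity, so no integration
  by parts may reach the boundary. Everything is therefore written in base coordinates, with area
  element \<open>W\<close> times Lebesgue measure, and tested against functions of compact support
  in \<open>G\<close>. This is what the truncation is for: since \<open>w\<close> is continuous on
  the closure and zero on the frontier, the part of \<open>G\<close> with
  \<open>norm x \<le> R\<close> and \<open>w x \<ge> \<epsilon>\<close> is compact, and
  \<open>F\<close> vanishes up to \<epsilon>.

  All geometry enters through two explicit vector fields on \<open>G\<close>: \<open>S\<close>, of
  divergence 0, and \<open>V\<close>, of divergence \<open>n W\<close>.

  The ratio n + 1 of successive radii is optimal for the method. With r = (\<beta> - 1) R the same
  argument yields s \<le> (n + 1) \<beta>^(n + 1) / (\<beta> - 1)^n, and the right-hand side is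
  smallest at \<beta> = n + 1. The factor n + 1 in front comes from the cylinder of radius and
  height R: its base has area \<open>\<omega>\<^sub>n R^n\<close>, its side n times as much.\<close>

lemma lborel_integral_translate:
  fixes f :: "'a::euclidean_space \<Rightarrow> real"
  assumes [measurable]: "f \<in> borel_measurable borel"
  shows "(\<integral>x. f (x + c) \<partial>lborel) = (\<integral>x. f x \<partial>lborel)"
proof -
  have "(\<integral>x. f x \<partial>lborel) = (\<integral>x. f x \<partial>(distr lborel borel ((+) c)))"
    by (simp add: lborel_distr_plus)
  also have "\<dots> = (\<integral>x. f (c + x) \<partial>lborel)"
    by (subst integral_distr) auto
  finally show ?thesis by (simp add: add.commute)
qed

text \<open>Difference quotients have integral 0 by translation invariance. The derivative is
  bounded and the supports stay in a fixed ball, so dominated convergence passes this on to the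
  derivative.\<close>

lemma integral_directional_derivative_eq_0:
  fixes f g :: "'a::euclidean_space \<Rightarrow> real" and e :: 'a
  assumes deriv: "\<And>x. ((\<lambda>t. f (x + t *\<^sub>R e)) has_real_derivative g x) (at 0)"
    and contf: "continuous_on UNIV f" and contg: "continuous_on UNIV g"
    and S: "bounded S" "\<And>x. x \<notin> S \<Longrightarrow> f x = 0" "\<And>x. x \<notin> S \<Longrightarrow> g x = 0"
  shows "integrable lborel g" "(\<integral>x. g x \<partial>lborel) = 0"
proof -
  obtain B where B: "\<And>x. x \<in> S \<Longrightarrow> norm x \<le> B" "0 < B"
    using S(1) by (auto simp: bounded_pos)
  have int_supp: "integrable lborel h" if "continuous_on UNIV h" "\<And>x. x \<notin> S \<Longrightarrow> h x = 0"
    for h :: "'a \<Rightarrow> real"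
  proof -
    have "integrable lborel (\<lambda>x. indicator (cball 0 B) x *\<^sub>R h x)"
      by (rule borel_integrable_compact) (auto intro: continuous_on_subset[OF that(1)])
    also have "(\<lambda>x. indicator (cball 0 B) x *\<^sub>R h x) = h"
      using that(2) B by (auto simp: fun_eq_iff indicator_def)
    finally show ?thesis .
  qed
  show "integrable lborel g" using int_supp contg S by blast
  have intf: "integrable lborel f" using int_supp contf S by blast
  have "compact (g ` cball 0 B)"
    by (rule compact_continuous_image) (auto intro: continuous_on_subset[OF contg])
  then obtain M where M: "\<And>x. norm x \<le> B \<Longrightarrow> \<bar>g x\<bar> \<le> M" "0 < M"
    by (auto dest!: compact_imp_bounded simp: bounded_pos) (metis mem_cball_0)
  have gM: "\<bar>g x\<bar> \<le> M" for x
    using M(1)[of x] M(2) B(1)[of x] S(3)[of x] by (cases "x \<in> S") auto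
  have deriv_t: "((\<lambda>t. f (x + t *\<^sub>R e)) has_real_derivative g (x + t *\<^sub>R e)) (at t)" for x t
    using deriv[of "x + t *\<^sub>R e"] DERIV_at_within_shift[of "\<lambda>s. f (x + s *\<^sub>R e)" "g (x + t *\<^sub>R e)" t 0 UNIV]
    by (simp add: algebra_simps)
  define D where "D k x = real (Suc k) * (f (x + (1 / real (Suc k)) *\<^sub>R e) - f x)" for k x
  have D_bound: "\<bar>D k x\<bar> \<le> M" for k x
  proof -
    have "norm (f (x + (1 / real (Suc k)) *\<^sub>R e) - f (x + 0 *\<^sub>R e)) \<le> M * norm (1 / real (Suc k) - 0)"
      by (rule field_differentiable_bound[where S = UNIV and f' = "\<lambda>t. g (x + t *\<^sub>R e)"])
        (use deriv_t gM in auto)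
    then have "\<bar>D k x\<bar> \<le> real (Suc k) * (M * (1 / real (Suc k)))"
      unfolding D_def abs_mult by (intro mult_mono) (auto simp del: of_nat_Suc)
    then show ?thesis by simp
  qed
  have D_supp: "D k x = 0" if "norm x > B + norm e" for k x
  proof -
    have "norm (x + (1 / real (Suc k)) *\<^sub>R e) \<ge> norm x - norm ((1 / real (Suc k)) *\<^sub>R e)"
      by (metis norm_diff_ineq)
    moreover have "norm ((1 / real (Suc k)) *\<^sub>R e) \<le> 1 * norm e"
      unfolding norm_scaleR by (intro mult_right_mono) auto
    ultimately have "norm (x + (1 / real (Suc k)) *\<^sub>R e) > B" using that by linarith
    moreover have "norm x > B" using that norm_ge_zero[of e] by linarith
    ultimately have "x \<notin> S" "x + (1 / real (Suc k)) *\<^sub>R e \<notin> S" using B(1) by force+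
    then show ?thesis using S(2) by (simp add: D_def)
  qed
  have intD: "(\<integral>x. D k x \<partial>lborel) = 0" for k
  proof -
    have "integrable lborel (\<lambda>x. f (x + (1 / real (Suc k)) *\<^sub>R e))"
      using integrable_distr[of "(+) ((1 / real (Suc k)) *\<^sub>R e)" lborel borel f] intf
      by (simp add: lborel_distr_plus add.commute)
    then show ?thesis unfolding D_def
      using intf borel_measurable_continuous_onI[OF contf] lborel_integral_translate[of f "(1 / real (Suc k)) *\<^sub>R e"] by simp
  qed
  have "(\<lambda>k. \<integral>x. D k x \<partial>lborel) \<longlonglongrightarrow> (\<integral>x. g x \<partial>lborel)"
  proof (rule integral_dominated_convergence[where w = "\<lambda>x. indicator (cball 0 (B + norm e)) x *\<^sub>R M"])
    show "g \<in> borel_measurable lborel"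
      using contg borel_measurable_continuous_onI by auto
    have "continuous_on UNIV (D k)" for k
      unfolding D_def by (intro continuous_intros continuous_on_compose2[OF contf]) auto
    then show "D k \<in> borel_measurable lborel" for k
      using borel_measurable_continuous_onI by auto
    show "integrable lborel (\<lambda>x. indicator (cball 0 (B + norm e)) x *\<^sub>R M :: real)"
      by (rule borel_integrable_compact) auto
    show "AE x in lborel. norm (D k x) \<le> indicator (cball 0 (B + norm e)) x *\<^sub>R M" for k
    proof (intro AE_I2)
      fix x show "norm (D k x) \<le> indicator (cball 0 (B + norm e)) x *\<^sub>R M"
        using D_bound[of k x] D_supp[of x k] by (cases "norm x \<le> B + norm e") (auto simp: indicator_def)
    qed
    show "AE x in lborel. (\<lambda>k. D k x) \<longlonglongrightarrow> g x"
    proof (intro AE_I2)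
      fix x
      have "((\<lambda>h. (f (x + h *\<^sub>R e) - f x) / h) \<longlongrightarrow> g x) (at 0)"
        using deriv[of x] by (simp add: has_field_derivative_iff)
      moreover have "filterlim (\<lambda>k. 1 / real (Suc k)) (at 0) sequentially"
        by (rule filterlim_atI[OF LIMSEQ_Suc[OF lim_1_over_n]]) auto
      ultimately have "(\<lambda>k. (f (x + (1 / real (Suc k)) *\<^sub>R e) - f x) / (1 / real (Suc k))) \<longlonglongrightarrow> g x"
        by (rule filterlim_compose)
      then show "(\<lambda>k. D k x) \<longlonglongrightarrow> g x" by (simp add: D_def mult.commute)
    qed
  qed
  then show "(\<integral>x. g x \<partial>lborel) = 0" by (simp add: intD LIMSEQ_const_iff)
qed

text \<open>Extended by zero, each component of \<open>f V\<close> is differentiable on the whole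
  space and supported in \<open>K\<close>, so the directional lemma applies to it along its own
  axis.\<close>

lemma integral_divergence_eq_0:
  fixes f :: "real^'n \<Rightarrow> real" and V :: "real^'n \<Rightarrow> real^'n"
  assumes G: "open G" and K: "compact K" "K \<subseteq> G" and f0: "\<And>x. x \<in> G - K \<Longrightarrow> f x = 0"
    and df: "\<And>x. x \<in> G \<Longrightarrow> (f has_derivative (\<lambda>h. df x \<bullet> h)) (at x)"
    and dV: "\<And>x. x \<in> G \<Longrightarrow> (V has_derivative V' x) (at x)"
    and cdf: "continuous_on G df" and cV': "\<And>i. continuous_on G (\<lambda>x. V' x (axis i 1))"
  shows "(LINT x:K|lborel. df x \<bullet> V x + f x * (\<Sum>i\<in>UNIV. V' x (axis i 1) $ i)) = 0"
proof -
  have openK: "open (- K)" using K compact_imp_closed by blast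
  have cf: "continuous_on G f" and cV: "continuous_on G V"
    using df dV by (meson continuous_at_imp_continuous_on has_derivative_continuous)+
  \<comment> \<open>The derivative must be supported in \<open>K\<close> as well. Off
    \<open>K\<close> the function \<open>f\<close> vanishes on an open set, hence so does its
    gradient.\<close>
  have df0: "df x = 0" if "x \<in> G - K" for x
  proof -
    have op: "open (G - K)" using G K by (auto intro: open_Diff compact_imp_closed)
    have "((\<lambda>_. 0) has_derivative (\<lambda>h. df x \<bullet> h)) (at x)"
      by (rule has_derivative_transform_within_open[OF df op]) (use that f0 in auto)
    then have "(\<lambda>h. df x \<bullet> h) = (\<lambda>_. 0)"
      using has_derivative_unique has_derivative_const by blast
    then have "df x \<bullet> df x = 0" by meson
    then show ?thesis by simp
  qed
  define F where "F i x = (if x \<in> G then f x * V x $ i else 0)" for i x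
  define g where "g i x = (if x \<in> G then df x $ i * V x $ i + f x * V' x (axis i 1) $ i else 0)" for i x
  \<comment> \<open>\<open>G\<close> and the complement of \<open>K\<close> are open and cover the
    space, so continuity may be checked on each.\<close>
  have cont: "continuous_on UNIV h"
    if "continuous_on G h" "\<And>x. x \<notin> K \<Longrightarrow> h x = 0" for h :: "real^'n \<Rightarrow> real"
  proof -
    have "continuous_on (G \<union> - K) h"
      by (rule continuous_on_open_Un[OF G openK that(1)])
        (rule continuous_on_eq[OF continuous_on_const[of _ 0]], simp add: that(2))
    moreover have "G \<union> - K = UNIV" using K by auto
    ultimately show ?thesis by simp
  qed
  have F0: "F i x = 0" and g0: "g i x = 0" if "x \<notin> K" for i x
    using that f0 df0 by (auto simp: F_def g_def)
  have cF: "continuous_on UNIV (F i)" for i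
  proof (rule cont)
    have "continuous_on G (\<lambda>x. f x * V x $ i)" by (intro continuous_intros cf cV)
    then show "continuous_on G (F i)" by (simp add: F_def cong: continuous_on_cong)
  qed (use F0 in auto)
  have cg: "continuous_on UNIV (g i)" for i
  proof (rule cont)
    have "continuous_on G (\<lambda>x. df x $ i * V x $ i + f x * V' x (axis i 1) $ i)"
      by (intro continuous_intros cf cV cdf cV')
    then show "continuous_on G (g i)" by (simp add: g_def cong: continuous_on_cong)
  qed (use g0 in auto)
  have der: "((\<lambda>t. F i (x + t *\<^sub>R axis i 1)) has_real_derivative g i x) (at 0)" for i x
  proof -
    have line: "((\<lambda>t. x + t *\<^sub>R axis i (1::real)) has_derivative (\<lambda>t. t *\<^sub>R axis i 1)) (at 0)"
      by (auto intro!: derivative_eq_intros)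
    have "(F i has_derivative (\<lambda>h. if x \<in> G then (df x \<bullet> h) * V x $ i + f x * V' x h $ i else 0)) (at x)"
    proof (cases "x \<in> G")
      case True
      have "((\<lambda>x. f x * V x $ i) has_derivative (\<lambda>h. (df x \<bullet> h) * V x $ i + f x * V' x h $ i)) (at x)"
        using has_derivative_mult[OF df[OF True]
            bounded_linear.has_derivative[OF bounded_linear_vec_nth dV[OF True]], of i]
        by (simp add: add.commute)
      then have "(F i has_derivative (\<lambda>h. (df x \<bullet> h) * V x $ i + f x * V' x h $ i)) (at x)"
        by (rule has_derivative_transform_within_open[OF _ G True]) (simp add: F_def)
      then show ?thesis using True by simp
    next
      case False
      then have "x \<in> - K" using K by auto
      have "((\<lambda>_. 0) has_derivative (\<lambda>_. 0::real)) (at x)" by simp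
      then have "(F i has_derivative (\<lambda>_. 0)) (at x)"
        by (rule has_derivative_transform_within_open[OF _ openK \<open>x \<in> - K\<close>]) (simp add: F0)
      then show ?thesis using False by simp
    qed
    then have F': "(F i has_derivative (\<lambda>h. if x \<in> G then (df x \<bullet> h) * V x $ i + f x * V' x h $ i else 0))
        (at (x + 0 *\<^sub>R axis i 1))" by simp
    have lin: "x \<in> G \<Longrightarrow> V' x (t *\<^sub>R axis i 1) = t *\<^sub>R V' x (axis i 1)" for t
      using dV[of x] by (simp add: has_derivative_def bounded_linear.linear linear_cmul)
    have eq: "(\<lambda>t. if x \<in> G then (df x \<bullet> (t *\<^sub>R axis i 1)) * V x $ i + f x * V' x (t *\<^sub>R axis i 1) $ i else 0)
        = (*) (g i x)"
      by (auto simp: fun_eq_iff g_def inner_axis lin algebra_simps)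
    show ?thesis
      using has_derivative_compose[OF line F'] unfolding has_field_derivative_def eq .
  qed
  have int: "integrable lborel (g i)" "(\<integral>x. g i x \<partial>lborel) = 0" for i
    using integral_directional_derivative_eq_0[OF der cF cg compact_imp_bounded[OF K(1)] F0 g0] by blast+
  have "(LINT x:K|lborel. df x \<bullet> V x + f x * (\<Sum>i\<in>UNIV. V' x (axis i 1) $ i)) = (\<integral>x. (\<Sum>i\<in>UNIV. g i x) \<partial>lborel)"
    unfolding set_lebesgue_integral_def
  proof (rule Bochner_Integration.integral_cong, simp)
    fix x :: "real^'n"
    show "indicator K x *\<^sub>R (df x \<bullet> V x + f x * (\<Sum>i\<in>UNIV. V' x (axis i 1) $ i)) = (\<Sum>i\<in>UNIV. g i x)"
      using K g0 by (auto simp: indicator_def g_def inner_vec_def sum.distrib sum_distrib_left)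
  qed
  also have "\<dots> = 0" using int by simp
  finally show ?thesis .
qed

section \<open>Smooth truncations\<close>

lemma exists_antiderivative:
  fixes g :: "real \<Rightarrow> real"
  assumes "continuous_on UNIV g"
  obtains F where "\<And>t. (F has_real_derivative g t) (at t)" "F a = 0"
proof -
  have "\<exists>F. \<forall>x. -\<infinity> < ereal x \<longrightarrow> ereal x < \<infinity> \<longrightarrow> (F has_vector_derivative g x) (at x)"
    by (rule einterval_antiderivative)
      (use assms in \<open>auto simp: continuous_on_eq_continuous_at\<close>)
  then obtain F where F: "\<And>t. (F has_real_derivative g t) (at t)"
    by (auto simp: has_real_derivative_iff_has_vector_derivative)
  show ?thesis
    by (rule that[of "\<lambda>t. F t - F a"]) (auto intro!: derivative_eq_intros F)
qed

lemma antiderivative_const: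
  fixes F g :: "real \<Rightarrow> real"
  assumes F: "\<And>t. (F has_real_derivative g t) (at t)"
    and "a \<le> b" "\<And>t. a \<le> t \<Longrightarrow> t \<le> b \<Longrightarrow> g t = 0"
  shows "F a = F b"
proof (rule antisym)
  show "F a \<le> F b"
    by (rule DERIV_nonneg_imp_nondecreasing) (use assms in \<open>auto intro!: exI[of _ 0], metis\<close>)
  show "F b \<le> F a"
    by (rule DERIV_nonpos_imp_nonincreasing) (use assms in \<open>auto intro!: exI[of _ 0], metis\<close>)
qed

text \<open>The normalised antiderivative of the parabolic bump
  \<open>max 0 ((t - a) * (b - t))\<close>. One continuous derivative is all that the test functions
  require.\<close>

lemma exists_smooth_step:
  fixes a b :: real
  assumes "a < b"
  obtains \<sigma> \<sigma>' where "\<And>t. (\<sigma> has_real_derivative \<sigma>' t) (at t)" "continuous_on UNIV \<sigma>'"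
    "\<And>t. 0 \<le> \<sigma>' t" "\<And>t. t \<le> a \<Longrightarrow> \<sigma>' t = 0" "\<And>t. b \<le> t \<Longrightarrow> \<sigma>' t = 0"
    "\<And>t. t \<le> a \<Longrightarrow> \<sigma> t = 0" "\<And>t. b \<le> t \<Longrightarrow> \<sigma> t = 1" "\<And>t. 0 \<le> \<sigma> t" "\<And>t. \<sigma> t \<le> 1"
proof -
  define g where "g t = max 0 ((t - a) * (b - t))" for t
  have cg: "continuous_on UNIV g" unfolding g_def by (intro continuous_intros)
  have g0: "g t = 0" if "t \<le> a \<or> b \<le> t" for t
    using that assms by (auto simp: g_def mult_nonneg_nonpos mult_nonpos_nonneg max_absorb1)
  have gpos: "g t \<ge> 0" for t by (simp add: g_def)
  obtain F where F: "\<And>t. (F has_real_derivative g t) (at t)" and Fa: "F a = 0"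
    using exists_antiderivative[OF cg] by metis
  have mono: "F s \<le> F t" if "s \<le> t" for s t
    by (rule DERIV_nonneg_imp_nondecreasing[OF that]) (use F gpos in blast)
  have L: "F t = 0" if "t \<le> a" for t
    using antiderivative_const[OF F that] g0 Fa by simp
  have R: "F t = F b" if "b \<le> t" for t
    using antiderivative_const[OF F that] g0 by simp
  have "F a \<noteq> F b"
  proof
    assume eq: "F a = F b"
    have const: "F t = 0" if "a \<le> t" "t \<le> b" for t
      using mono[OF that(1)] mono[OF that(2)] eq Fa by simp
    let ?m = "(a + b) / 2"
    have "((\<lambda>_. 0) has_real_derivative g ?m) (at ?m)"
      by (rule DERIV_cong_ev[THEN iffD1, OF refl _ refl F])
        (use assms const in \<open>auto simp: eventually_nhds intro!: exI[of _ "{a<..<b}"]\<close>)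
    then have "g ?m = 0" using DERIV_const DERIV_unique by blast
    moreover have "(?m - a) * (b - ?m) > 0" using assms by (intro mult_pos_pos) auto
    ultimately show False by (simp add: g_def)
  qed
  then have pos: "F b > 0" using mono[of a b] assms Fa by simp
  show ?thesis
  proof (rule that[of "\<lambda>t. F t / F b" "\<lambda>t. g t / F b"])
    show "((\<lambda>t. F t / F b) has_real_derivative g t / F b) (at t)" for t
      using DERIV_cdivide[OF F] .
    show "continuous_on UNIV (\<lambda>t. g t / F b)" using cg pos by (intro continuous_intros) auto
    show "0 \<le> g t / F b" for t using gpos pos by simp
    show "F t / F b = 1" if "b \<le> t" for t using R[OF that] pos by simp
    show "0 \<le> F t / F b" for t
      using L[of t] mono[of a t] Fa pos by (cases "t \<le> a") auto
    show "F t / F b \<le> 1" for t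
      using R[of t] mono[of t b] pos by (cases "b \<le> t") auto
  qed (auto simp: L g0)
qed

text \<open>The antiderivative of a smooth step from \<epsilon> to 2 \<epsilon> is a C^2 convex
  substitute for a shifted positive part. Slope at most 1 gives \<open>F t \<le> t\<close>; slope
  exactly 1 beyond 2 \<epsilon> gives positivity there.\<close>

lemma exists_convex_truncation:
  fixes \<epsilon> :: real
  assumes "0 < \<epsilon>"
  obtains F F' F'' where
    "\<And>t. (F has_real_derivative F' t) (at t)" "\<And>t. (F' has_real_derivative F'' t) (at t)"
    "continuous_on UNIV F''" "\<And>t. 0 \<le> F'' t" "\<And>t. 0 \<le> F' t" "\<And>t. 0 \<le> F t"
    "\<And>t. t \<le> \<epsilon> \<Longrightarrow> F t = 0" "\<And>t. t \<le> \<epsilon> \<Longrightarrow> F' t = 0"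
    "\<And>t. 0 \<le> t \<Longrightarrow> F t \<le> t" "\<And>t. 2 * \<epsilon> < t \<Longrightarrow> 0 < F t"
proof -
  obtain s s' where s: "\<And>t. (s has_real_derivative s' t) (at t)" "continuous_on UNIV s'"
    "\<And>t. 0 \<le> s' t" "\<And>t. t \<le> \<epsilon> \<Longrightarrow> s' t = 0"
    "\<And>t. t \<le> \<epsilon> \<Longrightarrow> s t = 0" "\<And>t. 2 * \<epsilon> \<le> t \<Longrightarrow> s t = 1" "\<And>t. 0 \<le> s t" "\<And>t. s t \<le> 1"
    using exists_smooth_step[of \<epsilon> "2 * \<epsilon>"] assms by (metis less_add_same_cancel1 mult_2)
  have cs: "continuous_on UNIV s"
    using s(1) by (meson DERIV_isCont continuous_at_imp_continuous_on)
  obtain F where F: "\<And>t. (F has_real_derivative s t) (at t)" "F \<epsilon> = 0"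
    using exists_antiderivative[OF cs] by metis
  have mono: "F u \<le> F t" if "u \<le> t" for u t
    by (rule DERIV_nonneg_imp_nondecreasing[OF that]) (use F s in blast)
  have L: "F t = 0" if "t \<le> \<epsilon>" for t
    using antiderivative_const[OF F(1) that] s F(2) by simp
  show ?thesis
  proof (rule that[OF F(1) s(1,2,3,7) _ L s(5)])
    show "0 \<le> F t" for t using L[of t] mono[of \<epsilon> t] F(2) by (cases "t \<le> \<epsilon>") auto
    show "F t \<le> t" if "0 \<le> t" for t
    proof -
      have "F t - t \<le> F 0 - 0"
        by (rule DERIV_nonpos_imp_nonincreasing[OF that, of "\<lambda>t. F t - t"])
          (auto intro!: exI[of _ "s _ - 1"] derivative_eq_intros F simp: s)
      then show ?thesis using L[of 0] assms by simp
    qed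
    show "0 < F t" if t: "2 * \<epsilon> < t" for t
    proof -
      have "F (2 * \<epsilon>) - 2 * \<epsilon> \<le> F t - t"
        by (rule DERIV_nonneg_imp_nondecreasing[of "2 * \<epsilon>" t "\<lambda>t. F t - t"])
          (use t in \<open>auto intro!: exI[of _ "0"] derivative_eq_intros F simp: s\<close>)
      then show ?thesis using mono[of \<epsilon> "2 * \<epsilon>"] F(2) t assms by linarith
    qed
  qed
qed

section \<open>Symmetry of the Hessian\<close>

text \<open>The second difference \<open>D h k t\<close> is symmetric in \<open>h\<close> and
  \<open>k\<close>, and equals \<open>t\<^sup>2 * (H k \<bullet> h)\<close> up to o(t^2). Only
  differentiability of the gradient at the single point \<open>x\<close> is used.\<close>

lemma has_derivative_gradient_symmetric:
  fixes f :: "'a::real_inner \<Rightarrow> real" and g :: "'a \<Rightarrow> 'a"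
  assumes G: "open G" "x \<in> G" and f: "\<And>y. y \<in> G \<Longrightarrow> (f has_derivative (\<lambda>h. g y \<bullet> h)) (at y)"
    and g: "(g has_derivative H) (at x)"
  shows "H h \<bullet> k = H k \<bullet> h"
proof -
  define D where "D h k t = f (x + t *\<^sub>R h + t *\<^sub>R k) - f (x + t *\<^sub>R h) - f (x + t *\<^sub>R k) + f x" for h k t
  have lin: "linear H" using g has_derivative_linear by blast
  have claim: "\<exists>d>0. \<forall>t. 0 < t \<and> t < d \<longrightarrow> \<bar>D h k t - t\<^sup>2 * (H k \<bullet> h)\<bar> \<le> e * t\<^sup>2"
    if e: "e > 0" for h k e
  proof -
    \<comment> \<open>The two remainders below are at most \<open>e / c * t\<close> times
      \<open>norm h + norm k\<close> and \<open>norm h\<close>; paired with \<open>h\<close> they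
      add up to this product. The summand 1 keeps \<open>c\<close> positive.\<close>
    define c where "c = (2 * norm h + norm k) * norm h + 1"
    have c: "c > 0" by (simp add: c_def add_nonneg_pos)
    have "e / c > 0" using e c by simp
    then obtain d1 where d1: "d1 > 0"
      "\<And>y. norm (y - x) < d1 \<Longrightarrow> norm (g y - g x - H (y - x)) \<le> e / c * norm (y - x)"
      using g unfolding has_derivative_at_alt by blast
    obtain d2 where d2: "d2 > 0" "ball x d2 \<subseteq> G" using G openE by blast
    define d where "d = min d1 d2 / (norm h + norm k + 1)"
    have nn: "norm h + norm k + 1 > 0" by (simp add: add_nonneg_pos)
    have d: "d > 0" using d1 d2 nn by (simp add: d_def)
    have "\<bar>D h k t - t\<^sup>2 * (H k \<bullet> h)\<bar> \<le> e * t\<^sup>2" if t: "0 < t" "t < d" for t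
    proof -
      have small: "norm (\<xi> *\<^sub>R h + \<eta> *\<^sub>R k) < min d1 d2" if "0 \<le> \<xi>" "\<xi> \<le> t" "0 \<le> \<eta>" "\<eta> \<le> t" for \<xi> \<eta>
      proof -
        have "norm (\<xi> *\<^sub>R h + \<eta> *\<^sub>R k) \<le> \<xi> * norm h + \<eta> * norm k"
          using norm_triangle_ineq[of "\<xi> *\<^sub>R h" "\<eta> *\<^sub>R k"] that by simp
        also have "\<dots> \<le> t * norm h + t * norm k" using that by (intro add_mono mult_right_mono) auto
        also have "\<dots> \<le> t * (norm h + norm k + 1)" using t by (simp add: algebra_simps)
        also have "\<dots> < d * (norm h + norm k + 1)" using t nn by simp
        also have "\<dots> = min d1 d2" using nn by (simp add: d_def)
        finally show ?thesis .
      qed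
      have inG: "x + (\<xi> *\<^sub>R h + \<eta> *\<^sub>R k) \<in> G" if "0 \<le> \<xi>" "\<xi> \<le> t" "0 \<le> \<eta>" "\<eta> \<le> t" for \<xi> \<eta>
        using small[OF that] d2 by (auto simp: subset_iff dist_norm norm_minus_commute)
      have der: "((\<lambda>s. f (x + (s *\<^sub>R h + \<eta> *\<^sub>R k))) has_real_derivative g (x + (s *\<^sub>R h + \<eta> *\<^sub>R k)) \<bullet> h) (at s)"
        if "0 \<le> s" "s \<le> t" "0 \<le> \<eta>" "\<eta> \<le> t" for s \<eta>
      proof -
        have "((\<lambda>s. x + (s *\<^sub>R h + \<eta> *\<^sub>R k)) has_derivative (\<lambda>s. s *\<^sub>R h)) (at s)"
          by (auto intro!: derivative_eq_intros)
        from has_derivative_compose[OF this f[OF inG[OF that]]] show ?thesis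
          by (simp add: has_field_derivative_def fun_eq_iff mult.commute[of _ "_ \<bullet> _"])
      qed
      \<comment> \<open>The mean value theorem is applied in the direction \<open>h\<close> to the
        increment in the direction \<open>k\<close>, so that only values of the gradient
        remain.\<close>
      define \<phi> where "\<phi> s = f (x + (s *\<^sub>R h + t *\<^sub>R k)) - f (x + (s *\<^sub>R h + 0 *\<^sub>R k))" for s
      have "\<exists>\<xi>. 0 < \<xi> \<and> \<xi> < t \<and> \<phi> t - \<phi> 0 = (t - 0) *
          (g (x + (\<xi> *\<^sub>R h + t *\<^sub>R k)) \<bullet> h - g (x + (\<xi> *\<^sub>R h + 0 *\<^sub>R k)) \<bullet> h)"
        unfolding \<phi>_def by (rule MVT2) (use t in \<open>auto intro!: DERIV_diff der[of _ t] der[of _ 0, simplified]\<close>)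
      then obtain \<xi> where \<xi>: "0 < \<xi>" "\<xi> < t" and mv: "\<phi> t - \<phi> 0 = t *
          ((g (x + (\<xi> *\<^sub>R h + t *\<^sub>R k)) - g (x + (\<xi> *\<^sub>R h + 0 *\<^sub>R k))) \<bullet> h)"
        by (auto simp: inner_diff_left)
      define r1 where "r1 = g (x + (\<xi> *\<^sub>R h + t *\<^sub>R k)) - g x - H (\<xi> *\<^sub>R h + t *\<^sub>R k)"
      define r0 where "r0 = g (x + (\<xi> *\<^sub>R h + 0 *\<^sub>R k)) - g x - H (\<xi> *\<^sub>R h + 0 *\<^sub>R k)"
      have "norm (\<xi> *\<^sub>R h + t *\<^sub>R k) \<le> \<xi> * norm h + t * norm k"
        using norm_triangle_ineq[of "\<xi> *\<^sub>R h" "t *\<^sub>R k"] \<xi> t by simp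
      also have "\<dots> \<le> t * (norm h + norm k)"
        using \<xi> by (simp add: distrib_left mult_right_mono)
      finally have n1: "norm (\<xi> *\<^sub>R h + t *\<^sub>R k) \<le> t * (norm h + norm k)" .
      have n0: "norm (\<xi> *\<^sub>R h + 0 *\<^sub>R k) \<le> t * norm h"
        using \<xi> by (simp add: mult_right_mono)
      have "norm r1 \<le> e / c * norm (\<xi> *\<^sub>R h + t *\<^sub>R k)"
        unfolding r1_def using d1(2)[of "x + (\<xi> *\<^sub>R h + t *\<^sub>R k)"] small[of \<xi> t] \<xi> by simp
      also have "\<dots> \<le> e / c * (t * (norm h + norm k))" using n1 e c by (intro mult_left_mono) auto
      finally have r1: "norm r1 \<le> e / c * (t * (norm h + norm k))" .
      have "norm r0 \<le> e / c * norm (\<xi> *\<^sub>R h + 0 *\<^sub>R k)"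
        unfolding r0_def using d1(2)[of "x + (\<xi> *\<^sub>R h + 0 *\<^sub>R k)"] small[of \<xi> 0] \<xi> by simp
      also have "\<dots> \<le> e / c * (t * norm h)" using n0 e c by (intro mult_left_mono) auto
      finally have r0: "norm r0 \<le> e / c * (t * norm h)" .
      have "D h k t = \<phi> t - \<phi> 0" by (simp add: D_def \<phi>_def algebra_simps)
      also have "\<dots> = t * ((t *\<^sub>R H k + (r1 - r0)) \<bullet> h)"
        unfolding mv r1_def r0_def by (simp add: linear_add[OF lin] linear_cmul[OF lin])
      finally have "D h k t - t\<^sup>2 * (H k \<bullet> h) = t * ((r1 - r0) \<bullet> h)"
        by (simp add: inner_add_left algebra_simps power2_eq_square)
      then have "\<bar>D h k t - t\<^sup>2 * (H k \<bullet> h)\<bar> = t * \<bar>(r1 - r0) \<bullet> h\<bar>"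
        using t by (simp add: abs_mult)
      also have "\<dots> \<le> t * (norm (r1 - r0) * norm h)"
        using t by (intro mult_left_mono Cauchy_Schwarz_ineq2) auto
      also have "\<dots> \<le> t * ((e / c * (t * (norm h + norm k)) + e / c * (t * norm h)) * norm h)"
        using t r1 r0 norm_triangle_ineq4[of r1 r0] by (intro mult_left_mono mult_right_mono) auto
      also have "\<dots> = e * t\<^sup>2 * (((2 * norm h + norm k) * norm h) / c)"
        by (simp add: divide_inverse algebra_simps power2_eq_square)
      also have "\<dots> \<le> e * t\<^sup>2 * 1"
        using e c by (intro mult_left_mono) (auto simp: c_def)
      finally show ?thesis by simp
    qed
    then show ?thesis using d by blast
  qed
  have sym: "D h k t = D k h t" for t by (simp add: D_def algebra_simps)
  have "\<bar>H k \<bullet> h - H h \<bullet> k\<bar> \<le> 2 * e" if e: "e > 0" for e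
  proof -
    obtain d1 where d1: "d1 > 0" "\<And>t. 0 < t \<Longrightarrow> t < d1 \<Longrightarrow> \<bar>D h k t - t\<^sup>2 * (H k \<bullet> h)\<bar> \<le> e * t\<^sup>2"
      using claim[OF e] by blast
    obtain d2 where d2: "d2 > 0" "\<And>t. 0 < t \<Longrightarrow> t < d2 \<Longrightarrow> \<bar>D k h t - t\<^sup>2 * (H h \<bullet> k)\<bar> \<le> e * t\<^sup>2"
      using claim[OF e] by blast
    define t where "t = min d1 d2 / 2"
    have t: "0 < t" "t < d1" "t < d2" using d1 d2 by (auto simp: t_def)
    have "\<bar>t\<^sup>2 * (H k \<bullet> h) - t\<^sup>2 * (H h \<bullet> k)\<bar> \<le> 2 * e * t\<^sup>2"
      using d1(2)[OF t(1,2)] d2(2)[OF t(1,3)] sym[of t] by linarith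
    moreover have "\<bar>t\<^sup>2 * (H k \<bullet> h) - t\<^sup>2 * (H h \<bullet> k)\<bar> = t\<^sup>2 * \<bar>H k \<bullet> h - H h \<bullet> k\<bar>"
      unfolding right_diff_distrib[symmetric] abs_mult by simp
    ultimately have "t\<^sup>2 * \<bar>H k \<bullet> h - H h \<bullet> k\<bar> \<le> t\<^sup>2 * (2 * e)"
      by (simp add: mult.commute)
    then show ?thesis using t by simp
  qed
  from this[of "\<bar>H k \<bullet> h - H h \<bullet> k\<bar> / 4"] show ?thesis by (cases "H k \<bullet> h = H h \<bullet> k") auto
qed

section \<open>Radial integrals\<close>

text \<open>Replacing \<open>p\<close> by \<open>s p\<close>, the derivative of the integrand in \<open>s\<close> is the divergence of
  \<open>(s / W) (p \<bullet> y) \<gamma> p\<close>. This avoids the change of variables formula, which the library has only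
  for well-ordered index types.\<close>

lemma tilted_integral_eq:
  fixes p :: "real^'n" and \<gamma> \<gamma>' :: "real \<Rightarrow> real"
  assumes d\<gamma>: "\<And>t. (\<gamma> has_real_derivative \<gamma>' t) (at t)" and c\<gamma>': "continuous_on UNIV \<gamma>'"
    and \<gamma>0: "\<And>t. 1 \<le> t \<Longrightarrow> \<gamma> t = 0"
  shows "(\<integral>y. sqrt (1 + (norm p)\<^sup>2) * \<gamma> ((norm y)\<^sup>2 + (p \<bullet> y)\<^sup>2) \<partial>lborel) = (\<integral>y. \<gamma> ((norm (y :: real^'n))\<^sup>2) \<partial>lborel)"
proof -
  define W where "W s = sqrt (1 + s\<^sup>2 * (norm p)\<^sup>2)" for s
  have Wpos: "W s > 0" for s unfolding W_def by (simp add: add_pos_nonneg)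
  have W2: "(W s)\<^sup>2 = 1 + s\<^sup>2 * (norm p)\<^sup>2" for s unfolding W_def by simp
  define Q where "Q s y = (norm y)\<^sup>2 + s\<^sup>2 * (p \<bullet> y)\<^sup>2" for s and y :: "real^'n"
  have c\<gamma>: "continuous_on UNIV \<gamma>" using d\<gamma> by (meson DERIV_isCont continuous_at_imp_continuous_on)
  obtain b where b: "cball (0::real^'n) 1 \<subseteq> cbox (-b) b"
    using bounded_subset_cbox_symmetric[OF bounded_cball] by metis
  have \<gamma>Q: "\<gamma> (Q s y) = 0" if "y \<notin> cbox (-b) b" for s y
  proof -
    have "norm y > 1" using that b by force
    then have "(norm y)\<^sup>2 \<ge> 1" by (simp add: one_le_power)
    then have "Q s y \<ge> 1" unfolding Q_def by (meson add_increasing2 mult_nonneg_nonneg zero_le_power2)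
    then show ?thesis by (rule \<gamma>0)
  qed
  have cQ: "continuous_on X (\<lambda>x. Q (f x) (g x))" if "continuous_on X f" "continuous_on X g"
    for X :: "('b::topological_space) set" and f g
    unfolding Q_def by (intro continuous_intros that)
  have cW: "continuous_on X (\<lambda>x. W (f x))" if "continuous_on X f" for X :: "('b::topological_space) set" and f
    unfolding W_def by (intro continuous_intros that)
  \<comment> \<open>The integral to be computed is that of a radial function over the tangent plane
    of slope \<open>p\<close>. \<open>I\<close> turns out to be constant in \<open>s\<close>, with
    the tilted integral at 1 and the flat one at 0. One box serves every \<open>s\<close>, because
    \<open>Q s y\<close> is at least the square of \<open>norm y\<close>.\<close>
  define I where "I s = integral (cbox (-b) b) (\<lambda>y. W s * \<gamma> (Q s y))" for s
  define h where "h s y = s * (norm p)\<^sup>2 / W s * \<gamma> (Q s y) + W s * (\<gamma>' (Q s y) * (2 * s * (p \<bullet> y)\<^sup>2))" for s y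
  have int_h: "integral (cbox (-b) b) (h s) = 0" for s
  proof -
    let ?df = "\<lambda>y. \<gamma>' (Q s y) *\<^sub>R (2 *\<^sub>R y + (2 * s\<^sup>2 * (p \<bullet> y)) *\<^sub>R p)"
    let ?V = "\<lambda>y. (s / W s * (p \<bullet> y)) *\<^sub>R p"
    have dQ: "(Q s has_derivative (\<lambda>h. (2 *\<^sub>R y + (2 * s\<^sup>2 * (p \<bullet> y)) *\<^sub>R p) \<bullet> h)) (at y)" for y
      unfolding Q_def power2_norm_eq_inner
      by (auto intro!: derivative_eq_intros simp: algebra_simps power2_eq_square inner_commute)
    have df: "((\<lambda>y. \<gamma> (Q s y)) has_derivative (\<lambda>h. ?df y \<bullet> h)) (at y)" for y
      using has_derivative_compose[OF dQ d\<gamma>[THEN has_field_derivative_imp_has_derivative]]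
      by (simp add: mult.commute)
    have dV: "(?V has_derivative (\<lambda>h. (s / W s * (p \<bullet> h)) *\<^sub>R p)) (at y)" for y
      using Wpos[of s] by (auto intro!: derivative_eq_intros)
    have "(LINT y:cbox (-b) b|lborel. ?df y \<bullet> ?V y + \<gamma> (Q s y) *
        (\<Sum>i\<in>UNIV. ((s / W s * (p \<bullet> axis i 1)) *\<^sub>R p) $ i)) = 0"
      by (rule integral_divergence_eq_0[OF open_UNIV compact_cbox _ _ df dV])
        (use \<gamma>Q in \<open>auto intro!: continuous_intros continuous_on_compose2[OF c\<gamma>'] cQ\<close>)
    also have "(\<lambda>y. ?df y \<bullet> ?V y + \<gamma> (Q s y) * (\<Sum>i\<in>UNIV. ((s / W s * (p \<bullet> axis i 1)) *\<^sub>R p) $ i)) = h s"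
    proof
      fix y
      have "(\<Sum>i\<in>UNIV. ((s / W s * (p \<bullet> axis i 1)) *\<^sub>R p) $ i) = s / W s * (norm p)\<^sup>2"
        by (simp add: power2_norm_eq_inner inner_vec_def[of p p] sum_distrib_left inner_axis algebra_simps)
      moreover have "?df y \<bullet> ?V y = W s * (\<gamma>' (Q s y) * (2 * s * (p \<bullet> y)\<^sup>2))"
      proof -
        have "?df y \<bullet> ?V y = \<gamma>' (Q s y) * (s / W s * (p \<bullet> y)) * (2 * (p \<bullet> y) * (1 + s\<^sup>2 * (norm p)\<^sup>2))"
          unfolding power2_norm_eq_inner
          by (simp add: inner_add_left algebra_simps inner_commute)
        also have "\<dots> = \<gamma>' (Q s y) * (s / W s * (p \<bullet> y)) * (2 * (p \<bullet> y) * (W s * W s))"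
          using W2[of s] by (simp add: power2_eq_square)
        also have "\<dots> = W s * (\<gamma>' (Q s y) * (2 * s * (p \<bullet> y)\<^sup>2))"
          using Wpos[of s] by (simp add: field_simps power2_eq_square)
        finally show ?thesis .
      qed
      ultimately show "?df y \<bullet> ?V y + \<gamma> (Q s y) * (\<Sum>i\<in>UNIV. ((s / W s * (p \<bullet> axis i 1)) *\<^sub>R p) $ i) = h s y"
        by (simp add: h_def)
    qed
    finally have 0: "(LINT y:cbox (-b) b|lborel. h s y) = 0" .
    have "continuous_on (cbox (-b) b) (h s)"
      unfolding h_def
      by (intro continuous_intros continuous_on_compose2[OF c\<gamma>] continuous_on_compose2[OF c\<gamma>'] cQ) (use Wpos in auto)
    then have "set_integrable lborel (cbox (-b) b) (h s)"
      unfolding set_integrable_def by (intro borel_integrable_compact) auto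
    from set_borel_integral_eq_integral(2)[OF this] 0 show ?thesis by simp
  qed
  have "(I has_real_derivative integral (cbox (-b) b) (h s)) (at s within UNIV)" for s
    unfolding I_def
  proof (rule leibniz_rule_field_derivative)
    fix s y
    have dW: "(W has_real_derivative s * (norm p)\<^sup>2 / W s) (at s)"
    proof -
      have pos: "1 + s\<^sup>2 * (norm p)\<^sup>2 > 0" by (simp add: add_pos_nonneg)
      have "((\<lambda>s. 1 + s\<^sup>2 * (norm p)\<^sup>2) has_real_derivative 2 * s * (norm p)\<^sup>2) (at s)"
        by (auto intro!: derivative_eq_intros)
      from DERIV_chain2[where f = sqrt and g = "\<lambda>s. 1 + s\<^sup>2 * (norm p)\<^sup>2", OF DERIV_real_sqrt[OF pos] this]
      have "(W has_real_derivative inverse (sqrt (1 + s\<^sup>2 * (norm p)\<^sup>2)) / 2 * (2 * s * (norm p)\<^sup>2)) (at s)"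
        by (simp only: W_def[abs_def])
      moreover have "inverse (sqrt (1 + s\<^sup>2 * (norm p)\<^sup>2)) / 2 * (2 * s * (norm p)\<^sup>2) = s * (norm p)\<^sup>2 / W s"
        by (simp add: W_def field_simps)
      ultimately show ?thesis by (rule DERIV_cong)
    qed
    have dQ: "((\<lambda>s. Q s y) has_real_derivative 2 * s * (p \<bullet> y)\<^sup>2) (at s)"
      unfolding Q_def by (auto intro!: derivative_eq_intros)
    show "((\<lambda>s. W s * \<gamma> (Q s y)) has_real_derivative h s y) (at s within UNIV)"
      using DERIV_mult[OF dW DERIV_chain2[OF d\<gamma> dQ]] by (simp add: h_def mult.commute[of _ "W s"])
  next
    show "(\<lambda>y. W s * \<gamma> (Q s y)) integrable_on cbox (-b) b" for s
      by (intro integrable_continuous continuous_intros continuous_on_compose2[OF c\<gamma>] cQ) auto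
    show "continuous_on (UNIV \<times> cbox (-b) b) (\<lambda>(s, y). h s y)"
      unfolding h_def split_beta
      by (intro continuous_intros continuous_on_compose2[OF c\<gamma>] continuous_on_compose2[OF c\<gamma>'] cQ cW)
        (use Wpos in \<open>auto simp: less_imp_neq[symmetric]\<close>)
  qed auto
  then have "\<And>s. (I has_real_derivative 0) (at s)" by (simp add: int_h)
  then have I01: "I 1 = I 0" by (metis DERIV_isconst_all)
  have conv: "(\<integral>y. W s * \<gamma> (Q s y) \<partial>lborel) = I s" for s
  proof -
    have "set_integrable lborel (cbox (-b) b) (\<lambda>y. W s * \<gamma> (Q s y))"
      unfolding set_integrable_def
      by (intro borel_integrable_compact continuous_intros continuous_on_compose2[OF c\<gamma>] cQ) auto
    from set_borel_integral_eq_integral(2)[OF this]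
    have "I s = (LINT y:cbox (-b) b|lborel. W s * \<gamma> (Q s y))" unfolding I_def by (rule sym)
    also have "\<dots> = (\<integral>y. W s * \<gamma> (Q s y) \<partial>lborel)"
      unfolding set_lebesgue_integral_def
      by (rule Bochner_Integration.integral_cong) (auto simp: indicator_def \<gamma>Q)
    finally show ?thesis by simp
  qed
  have "(\<integral>y. W 1 * \<gamma> (Q 1 y) \<partial>lborel) = (\<integral>y. W 0 * \<gamma> (Q 0 y) \<partial>lborel)"
    by (simp only: conv I01)
  then show ?thesis by (simp add: W_def Q_def)
qed

text \<open>This weight makes one test function compare two scales, so the mass never has to be
  differentiated in the radius. \<open>\<psi> q\<close> is the integral over \<open>t\<close> from
  \<open>a\<close> to \<open>b\<close> of \<open>\<gamma> (q / t^2) / t^(n + 1)\<close>; then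
  \<open>n \<psi> + 2 q \<psi>'\<close> integrates the t-derivative of
  \<open>- \<gamma> (q / t^2) / t^n\<close>.\<close>

lemma exists_scale_average:
  fixes \<gamma> \<gamma>' :: "real \<Rightarrow> real" and a b :: real and n :: nat
  assumes ab: "0 < a" "a < b"
    and d\<gamma>: "\<And>t. (\<gamma> has_real_derivative \<gamma>' t) (at t)" and c\<gamma>': "continuous_on UNIV \<gamma>'"
    and \<gamma>'neg: "\<And>t. \<gamma>' t \<le> 0" and \<gamma>nn: "\<And>t. 0 \<le> \<gamma> t" and \<gamma>0: "\<And>t. 1 \<le> t \<Longrightarrow> \<gamma> t = 0"
  obtains \<psi> \<psi>' where
    "\<And>q. (\<psi> has_real_derivative \<psi>' q) (at q)" "continuous_on UNIV \<psi>'"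
    "\<And>q. \<psi>' q \<le> 0" "\<And>q. 0 \<le> \<psi> q" "\<And>q. b\<^sup>2 \<le> q \<Longrightarrow> \<psi> q = 0"
    "\<And>q. real n * \<psi> q + 2 * q * \<psi>' q = \<gamma> (q / a\<^sup>2) / a ^ n - \<gamma> (q / b\<^sup>2) / b ^ n"
proof -
  have c\<gamma>: "continuous_on UNIV \<gamma>" using d\<gamma> by (meson DERIV_isCont continuous_at_imp_continuous_on)
  define k where "k q t = \<gamma> (q / t\<^sup>2) / t ^ (n + 1)" for q t :: real
  define k' where "k' q t = \<gamma>' (q / t\<^sup>2) / t ^ (n + 3)" for q t :: real
  define \<psi> where "\<psi> q = integral (cbox a b) (k q)" for q
  define \<psi>' where "\<psi>' q = integral (cbox a b) (k' q)" for q
  have ck: "continuous_on (cbox a b) (k q)" for q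
    unfolding k_def using ab
    by (intro continuous_intros continuous_on_compose2[OF c\<gamma>]) auto
  have ck': "continuous_on (UNIV \<times> cbox a b) (\<lambda>(q, t). k' q t)"
    unfolding k'_def split_beta using ab
    by (intro continuous_intros continuous_on_compose2[OF c\<gamma>']) auto
  have ck'1: "continuous_on (cbox a b) (k' q)" for q
    unfolding k'_def using ab
    by (intro continuous_intros continuous_on_compose2[OF c\<gamma>']) auto
  have ge1: "1 \<le> q / t\<^sup>2" if "b\<^sup>2 \<le> q" "t \<in> cbox a b" for q t
  proof -
    have "t\<^sup>2 \<le> b\<^sup>2" using that ab by (intro power_mono) auto
    then have "t\<^sup>2 \<le> q" using that(1) by (rule order_trans)
    then show ?thesis using that ab by (simp add: field_simps)
  qed
  show ?thesis
  proof (rule that[of \<psi> \<psi>'])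
    have "(\<psi> has_real_derivative \<psi>' q) (at q within UNIV)" for q
      unfolding \<psi>_def \<psi>'_def
    proof (rule leibniz_rule_field_derivative)
      fix q t assume "t \<in> cbox a b"
      then have t: "a \<le> t" by simp
      have "((\<lambda>q. \<gamma> (q / t\<^sup>2)) has_real_derivative \<gamma>' (q / t\<^sup>2) * (1 / t\<^sup>2)) (at q)"
        by (rule DERIV_chain2[OF d\<gamma> DERIV_cdivide[OF DERIV_ident]])
      from DERIV_cdivide[OF this, of "t ^ (n + 1)"]
      have "((\<lambda>q. \<gamma> (q / t\<^sup>2) / t ^ (n + 1)) has_real_derivative \<gamma>' (q / t\<^sup>2) * (1 / t\<^sup>2) / t ^ (n + 1)) (at q)" .
      moreover have "\<gamma>' (q / t\<^sup>2) * (1 / t\<^sup>2) / t ^ (n + 1) = \<gamma>' (q / t\<^sup>2) / t ^ (n + 3)"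
        by (simp add: eval_nat_numeral mult_ac)
      ultimately have "((\<lambda>q. \<gamma> (q / t\<^sup>2) / t ^ (n + 1)) has_real_derivative \<gamma>' (q / t\<^sup>2) / t ^ (n + 3)) (at q)"
        by (rule DERIV_cong)
      then show "((\<lambda>q. k q t) has_real_derivative k' q t) (at q within UNIV)"
        unfolding k_def k'_def .
    qed (rule integrable_continuous[OF ck], rule ck', simp_all)
    then show "(\<psi> has_real_derivative \<psi>' q) (at q)" for q by simp
    show "continuous_on UNIV \<psi>'"
      unfolding \<psi>'_def by (rule integral_continuous_on_param[OF ck'])
    show "\<psi>' q \<le> 0" for q
    proof -
      have "\<psi>' q \<le> integral (cbox a b) (\<lambda>_. 0)"
        unfolding \<psi>'_def using ab \<gamma>'neg
        by (intro integral_le integrable_continuous ck'1) (auto simp: k'_def divide_nonpos_pos)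
      then show ?thesis by simp
    qed
    show "0 \<le> \<psi> q" for q
      unfolding \<psi>_def using ab \<gamma>nn
      by (intro integral_nonneg integrable_continuous ck) (auto simp: k_def)
    show "\<psi> q = 0" if "b\<^sup>2 \<le> q" for q
    proof -
      have "\<psi> q = integral (cbox a b) (\<lambda>_. 0)" unfolding \<psi>_def
        by (rule integral_cong) (use ge1[OF that] \<gamma>0 in \<open>auto simp: k_def\<close>)
      then show ?thesis by simp
    qed
    show "real n * \<psi> q + 2 * q * \<psi>' q = \<gamma> (q / a\<^sup>2) / a ^ n - \<gamma> (q / b\<^sup>2) / b ^ n" for q
    proof -
      have "((\<lambda>t. real n * k q t + 2 * q * k' q t) has_integral
          - (\<gamma> (q / b\<^sup>2) / b ^ n) - - (\<gamma> (q / a\<^sup>2) / a ^ n)) {a..b}"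
      proof (rule fundamental_theorem_of_calculus)
        fix t assume t: "t \<in> {a..b}"
        then have t0: "t > 0" using ab by simp
        have dq: "((\<lambda>t. q / t\<^sup>2) has_real_derivative - (2 * q / t ^ 3)) (at t)"
          using t0 by (auto intro!: derivative_eq_intros simp: field_simps power2_eq_square power3_eq_cube)
        have dp: "((\<lambda>t. inverse (t ^ n)) has_real_derivative - (real n / t ^ (n + 1))) (at t)"
        proof (cases n)
          case (Suc m)
          have "((\<lambda>t. inverse (t ^ n)) has_real_derivative - (real n * t ^ m * inverse ((t ^ n) ^ Suc (Suc 0)))) (at t)"
            using DERIV_inverse_fun[OF DERIV_pow[of n t UNIV]] t0 Suc by simp
          then show ?thesis
            by (rule DERIV_cong) (use t0 Suc in \<open>simp add: field_simps\<close>)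
        qed simp
        have "((\<lambda>t. - (\<gamma> (q / t\<^sup>2) * inverse (t ^ n))) has_real_derivative
            - (\<gamma>' (q / t\<^sup>2) * - (2 * q / t ^ 3) * inverse (t ^ n) + - (real n / t ^ (n + 1)) * \<gamma> (q / t\<^sup>2))) (at t)"
          by (rule DERIV_minus[OF DERIV_mult[OF DERIV_chain2[OF d\<gamma> dq] dp]])
        moreover have "- (\<gamma>' (q / t\<^sup>2) * - (2 * q / t ^ 3) * inverse (t ^ n) + - (real n / t ^ (n + 1)) * \<gamma> (q / t\<^sup>2))
            = real n * k q t + 2 * q * k' q t"
          using t0 by (simp add: k_def k'_def divide_inverse power_add algebra_simps)
        ultimately have "((\<lambda>t. - (\<gamma> (q / t\<^sup>2) / t ^ n)) has_real_derivative real n * k q t + 2 * q * k' q t) (at t)"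
          by (simp add: divide_inverse)
        then show "((\<lambda>t. - (\<gamma> (q / t\<^sup>2) / t ^ n)) has_vector_derivative real n * k q t + 2 * q * k' q t) (at t within {a..b})"
          by (simp add: has_real_derivative_iff_has_vector_derivative has_vector_derivative_at_within)
      qed (use ab in simp)
      moreover have "((\<lambda>t. real n * k q t + 2 * q * k' q t) has_integral real n * \<psi> q + 2 * q * \<psi>' q) {a..b}"
        unfolding \<psi>_def \<psi>'_def
        using integrable_integral[OF integrable_continuous[OF ck[of q]]]
          integrable_integral[OF integrable_continuous[OF ck'1[of q]]]
        by (intro has_integral_add has_integral_mult_right) auto
      ultimately have "- (\<gamma> (q / b\<^sup>2) / b ^ n) - - (\<gamma> (q / a\<^sup>2) / a ^ n) = real n * \<psi> q + 2 * q * \<psi>' q"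
        by (rule has_integral_unique)
      then show ?thesis by linarith
    qed
  qed
qed

section \<open>Minimal graphs\<close>

lemma sum_linear_axis:
  fixes f :: "real^'n \<Rightarrow> real"
  assumes "linear f"
  shows "(\<Sum>i\<in>UNIV. f (axis i 1) * y $ i) = f y"
proof -
  have "f y = f (\<Sum>i\<in>UNIV. (y $ i) *\<^sub>R axis i 1)"
    using basis_expansion[of y] by (simp add: scalar_mult_eq_scaleR)
  then show ?thesis by (simp add: linear_sum[OF assms] linear_cmul[OF assms] mult.commute)
qed

lemma set_integrable_compact_continuous:
  fixes f :: "'a::euclidean_space \<Rightarrow> real"
  assumes "compact K" "continuous_on K f"
  shows "set_integrable lborel K f"
  unfolding set_integrable_def using borel_integrable_compact[OF assms] .

section \<open>The area element of a graph\<close>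

definition area_factor :: "'a::real_inner \<Rightarrow> real" where
  "area_factor v = sqrt (1 + (norm v)\<^sup>2)"

lemma area_factor_pos: "0 < area_factor v"
  by (simp add: area_factor_def add_pos_nonneg)

lemma area_factor_square: "(area_factor v)\<^sup>2 = 1 + (norm v)\<^sup>2"
  by (simp add: area_factor_def)

lemma continuous_on_area_factor [continuous_intros]:
  "continuous_on X f \<Longrightarrow> continuous_on X (\<lambda>x. area_factor (f x))"
  unfolding area_factor_def by (intro continuous_intros)

lemma has_derivative_area_factor:
  "(area_factor has_derivative (\<lambda>h. v \<bullet> h / area_factor v)) (at v)"
proof -
  have pos: "0 < 1 + v \<bullet> v" by (simp add: add_pos_nonneg)
  have "((\<lambda>v. 1 + v \<bullet> v) has_derivative (\<lambda>h. 2 * (v \<bullet> h))) (at v)"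
    by (auto intro!: derivative_eq_intros simp: inner_commute)
  from has_derivative_compose[OF this DERIV_real_sqrt[OF pos, THEN has_field_derivative_imp_has_derivative]]
  show ?thesis
    by (simp add: area_factor_def[abs_def] power2_norm_eq_inner field_simps)
qed

text \<open>The boundary condition survives only as \<open>compact_superlevel\<close>, which is what
  gives test functions compact support. \<open>nondivergence_eq\<close> is the minimal surface
  equation with the divergence expanded and multiplied by \<open>W^3\<close>.\<close>

locale minimal_graph =
  fixes G :: "(real^'n) set" and w :: "real^'n \<Rightarrow> real"
    and p :: "real^'n \<Rightarrow> real^'n" and H :: "real^'n \<Rightarrow> real^'n \<Rightarrow> real^'n"
  assumes open_G: "open G"
    and dw: "\<And>x. x \<in> G \<Longrightarrow> (w has_derivative (\<lambda>h. p x \<bullet> h)) (at x)"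
    and dp: "\<And>x. x \<in> G \<Longrightarrow> (p has_derivative H x) (at x)"
    and cont_H: "\<And>i. continuous_on G (\<lambda>x. H x (axis i 1))"
    and nondivergence_eq: "\<And>x. x \<in> G \<Longrightarrow>
      (area_factor (p x))\<^sup>2 * (\<Sum>i\<in>UNIV. H x (axis i 1) $ i) = p x \<bullet> H x (p x)"
    and w_nonneg: "\<And>x. x \<in> G \<Longrightarrow> 0 \<le> w x"
    and compact_superlevel: "\<And>\<epsilon> R. 0 < \<epsilon> \<Longrightarrow> compact {x \<in> G. norm x \<le> R \<and> \<epsilon> \<le> w x}"
begin

abbreviation W where "W x \<equiv> area_factor (p x)"

text \<open>The flux in the minimal surface equation. It is also \<open>W\<close> times the
  horizontal part of the tangential gradient of the height, so that \<open>div_S\<close> expresses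
  harmonicity of the height on the graph.\<close>

definition S where "S x = (1 / W x) *\<^sub>R p x"

definition S' where "S' x h = (1 / W x) *\<^sub>R H x h - (p x \<bullet> H x h / W x ^ 3) *\<^sub>R p x"

text \<open>\<open>W\<close> times the tangential part of the position vector of the graph relative to \<open>(x0, w0)\<close>.\<close>

definition V where
  "V x0 w0 x = W x *\<^sub>R (x - x0) + ((w x - w0) - (x - x0) \<bullet> p x) *\<^sub>R S x"

definition V' where
  "V' x0 w0 x h = (p x \<bullet> H x h / W x) *\<^sub>R (x - x0) + W x *\<^sub>R h
    - ((x - x0) \<bullet> H x h) *\<^sub>R S x + ((w x - w0) - (x - x0) \<bullet> p x) *\<^sub>R S' x h"

lemma W_pos: "0 < W x" by (rule area_factor_pos)

lemma cont_w: "continuous_on G w" and cont_p: "continuous_on G p"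
  using dw dp by (meson continuous_at_imp_continuous_on has_derivative_continuous)+

lemma linear_H: "x \<in> G \<Longrightarrow> linear (H x)"
  using dp has_derivative_linear by blast

lemma H_symmetric: "x \<in> G \<Longrightarrow> H x h \<bullet> k = H x k \<bullet> h"
  using has_derivative_gradient_symmetric[OF open_G _ dw dp] .

lemma dW: "x \<in> G \<Longrightarrow> ((\<lambda>x. W x) has_derivative (\<lambda>h. p x \<bullet> H x h / W x)) (at x)"
  using has_derivative_compose[OF dp has_derivative_area_factor] .

lemma dS: assumes x: "x \<in> G" shows "(S has_derivative S' x) (at x)"
proof -
  have "((\<lambda>x. 1 / W x) has_derivative (\<lambda>h. - (p x \<bullet> H x h / W x ^ 3))) (at x)"
    using W_pos[of x]
    by (auto intro!: derivative_eq_intros dW[OF x] simp: field_simps power2_eq_square power3_eq_cube)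
  from has_derivative_scaleR[OF this dp[OF x]]
  show ?thesis unfolding S_def[abs_def] S'_def[abs_def]
    by (simp add: algebra_simps)
qed

lemma dV: assumes x: "x \<in> G" shows "(V x0 w0 has_derivative V' x0 w0 x) (at x)"
proof -
  have c: "((\<lambda>x. (w x - w0) - (x - x0) \<bullet> p x) has_derivative (\<lambda>h. - ((x - x0) \<bullet> H x h))) (at x)"
    by (auto intro!: derivative_eq_intros dw[OF x] dp[OF x] simp: inner_commute algebra_simps)
  have y: "((\<lambda>x. x - x0) has_derivative (\<lambda>h. h)) (at x)"
    by (auto intro!: derivative_eq_intros)
  from has_derivative_add[OF has_derivative_scaleR[OF dW[OF x] y] has_derivative_scaleR[OF c dS[OF x]]]
  show ?thesis unfolding V_def[abs_def] V'_def[abs_def]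
    by (rule has_derivative_eq_rhs) (auto simp: algebra_simps)
qed

lemma cont_S: "continuous_on G S"
  using dS by (meson continuous_at_imp_continuous_on has_derivative_continuous)

lemma cont_V: "continuous_on G (V x0 w0)"
  using dV by (meson continuous_at_imp_continuous_on has_derivative_continuous)

lemma cont_S': "continuous_on G (\<lambda>x. S' x (axis i 1))"
  unfolding S'_def by (intro continuous_intros cont_p cont_H) (use W_pos in \<open>auto simp: less_imp_neq[symmetric]\<close>)

lemma cont_V': "continuous_on G (\<lambda>x. V' x0 w0 x (axis i 1))"
  unfolding V'_def by (intro continuous_intros cont_p cont_w cont_H cont_S cont_S')
    (use W_pos in \<open>auto simp: less_imp_neq[symmetric]\<close>)

lemma div_S: assumes x: "x \<in> G" shows "(\<Sum>i\<in>UNIV. S' x (axis i 1) $ i) = 0"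
proof -
  have "linear (\<lambda>h. p x \<bullet> H x h)"
    by (intro linearI) (auto simp: linear_add[OF linear_H[OF x]] linear_cmul[OF linear_H[OF x]] inner_add_right)
  from sum_linear_axis[OF this, of "p x"]
  have "(\<Sum>i\<in>UNIV. S' x (axis i 1) $ i) = (\<Sum>i\<in>UNIV. H x (axis i 1) $ i) / W x - (p x \<bullet> H x (p x)) / W x ^ 3"
    by (simp add: S'_def sum_subtractf sum_divide_distrib[symmetric])
  also have "\<dots> = 0"
    using W_pos[of x] unfolding nondivergence_eq[OF x, symmetric] by (simp add: power2_eq_square power3_eq_cube)
  finally show ?thesis .
qed

text \<open>On a minimal hypersurface the tangential position field has divergence equal to the
  dimension. In coordinates the two Hessian terms cancel by symmetry, and \<open>div_S\<close>
  removes the derivative of \<open>S\<close>.\<close>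

lemma div_V: assumes x: "x \<in> G"
  shows "(\<Sum>i\<in>UNIV. V' x0 w0 x (axis i 1) $ i) = real CARD('n) * W x"
proof -
  let ?y = "x - x0" and ?c = "(w x - w0) - (x - x0) \<bullet> p x"
  have lin: "linear (\<lambda>h. v \<bullet> H x h)" for v
    by (intro linearI) (auto simp: linear_add[OF linear_H[OF x]] linear_cmul[OF linear_H[OF x]] inner_add_right)
  have "(\<Sum>i\<in>UNIV. V' x0 w0 x (axis i 1) $ i)
      = (\<Sum>i\<in>UNIV. p x \<bullet> H x (axis i 1) * ?y $ i) / W x + (\<Sum>i\<in>(UNIV::'n set). W x)
        - (\<Sum>i\<in>UNIV. ?y \<bullet> H x (axis i 1) * p x $ i) / W x + ?c * (\<Sum>i\<in>UNIV. S' x (axis i 1) $ i)"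
    unfolding sum_divide_distrib sum_distrib_left sum.distrib[symmetric] sum_subtractf[symmetric]
    by (rule sum.cong) (auto simp: V'_def S_def)
  also have "\<dots> = p x \<bullet> H x ?y / W x + real CARD('n) * W x - ?y \<bullet> H x (p x) / W x"
    unfolding sum_linear_axis[OF lin] div_S[OF x] by simp
  also have "p x \<bullet> H x ?y = ?y \<bullet> H x (p x)"
    using H_symmetric[OF x] by (simp add: inner_commute)
  finally show ?thesis by simp
qed

lemma integral_test_S:
  assumes "compact K" "K \<subseteq> G" "\<And>x. x \<in> G - K \<Longrightarrow> f x = 0"
    and "\<And>x. x \<in> G \<Longrightarrow> (f has_derivative (\<lambda>h. df x \<bullet> h)) (at x)" "continuous_on G df"
  shows "(LINT x:K|lborel. df x \<bullet> S x) = 0"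
proof -
  have "(LINT x:K|lborel. df x \<bullet> S x)
      = (LINT x:K|lborel. df x \<bullet> S x + f x * (\<Sum>i\<in>UNIV. S' x (axis i 1) $ i))"
    by (rule set_lebesgue_integral_cong)
      (use assms(1,2) div_S in \<open>auto simp: subset_iff intro: borel_compact\<close>)
  also have "\<dots> = 0"
    by (rule integral_divergence_eq_0[OF open_G assms(1-4) dS assms(5) cont_S'])
  finally show ?thesis .
qed

lemma integral_test_V:
  assumes "compact K" "K \<subseteq> G" "\<And>x. x \<in> G - K \<Longrightarrow> f x = 0"
    and "\<And>x. x \<in> G \<Longrightarrow> (f has_derivative (\<lambda>h. df x \<bullet> h)) (at x)" "continuous_on G df"
  shows "(LINT x:K|lborel. df x \<bullet> V x0 w0 x + f x * (real CARD('n) * W x)) = 0"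
proof -
  have "(LINT x:K|lborel. df x \<bullet> V x0 w0 x + f x * (real CARD('n) * W x))
      = (LINT x:K|lborel. df x \<bullet> V x0 w0 x + f x * (\<Sum>i\<in>UNIV. V' x0 w0 x (axis i 1) $ i))"
    by (rule set_lebesgue_integral_cong)
      (use assms(1,2) div_V in \<open>auto simp: subset_iff intro: borel_compact\<close>)
  also have "\<dots> = 0"
    by (rule integral_divergence_eq_0[OF open_G assms(1-4) dV assms(5) cont_V'])
  finally show ?thesis .
qed

end

section \<open>Monotonicity and the mean value inequality\<close>

lemma lborel_integral_affine:
  fixes f :: "'a::euclidean_space \<Rightarrow> real"
  assumes [measurable]: "f \<in> borel_measurable borel" and c: "0 < c"
  shows "(\<integral>x. f x \<partial>lborel) = c ^ DIM('a) * (\<integral>x. f (t + c *\<^sub>R x) \<partial>lborel)"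
proof -
  have "(\<integral>x. f x \<partial>lborel)
      = (\<integral>x. f x \<partial>(density (distr lborel borel (\<lambda>x. t + c *\<^sub>R x)) (\<lambda>_. \<bar>c\<bar> ^ DIM('a))))"
    using c by (subst lborel_affine[of c t]) auto
  also have "\<dots> = (\<integral>x. c ^ DIM('a) * f x \<partial>(distr lborel borel (\<lambda>x. t + c *\<^sub>R x)))"
    using c by (subst integral_density) auto
  also have "\<dots> = (\<integral>x. c ^ DIM('a) * f (t + c *\<^sub>R x) \<partial>lborel)"
    by (subst integral_distr) auto
  finally show ?thesis by simp
qed

locale truncated_minimal_graph = minimal_graph G w p H
  for G :: "(real^'n) set" and w :: "real^'n \<Rightarrow> real"
    and p :: "real^'n \<Rightarrow> real^'n" and H :: "real^'n \<Rightarrow> real^'n \<Rightarrow> real^'n" +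
  fixes \<epsilon> :: real and F F' F'' :: "real \<Rightarrow> real"
  assumes \<epsilon>_pos: "0 < \<epsilon>"
    and dF: "\<And>t. (F has_real_derivative F' t) (at t)"
    and dF': "\<And>t. (F' has_real_derivative F'' t) (at t)"
    and cont_F'': "continuous_on UNIV F''"
    and F''_nonneg: "\<And>t. 0 \<le> F'' t" and F'_nonneg: "\<And>t. 0 \<le> F' t" and F_nonneg: "\<And>t. 0 \<le> F t"
    and F_0: "\<And>t. t \<le> \<epsilon> \<Longrightarrow> F t = 0" and F'_0: "\<And>t. t \<le> \<epsilon> \<Longrightarrow> F' t = 0"
    and F_le: "\<And>t. 0 \<le> t \<Longrightarrow> F t \<le> t"
begin

definition K where "K R = {x \<in> G. norm x \<le> R \<and> \<epsilon> \<le> w x}"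

text \<open>\<open>K\<close> carries the radial test functions, whose weight already limits the
  height. The bound on \<open>w\<close> in \<open>D\<close> is needed for the area estimate and for
  replacing \<open>F (w x)\<close> by \<open>R\<close>.\<close>

definition D where "D R = {x \<in> G. norm x \<le> R \<and> \<epsilon> \<le> w x \<and> w x \<le> R}"

definition mass where "mass R = (LINT x:D R|lborel. F (w x) * W x)"

definition area where "area R = (LINT x:D R|lborel. W x)"

lemma K_subset: "K R \<subseteq> G" and D_subset: "D R \<subseteq> G" and D_subset_K: "D R \<subseteq> K R"
  by (auto simp: K_def D_def)

lemma compact_K: "compact (K R)"
  unfolding K_def by (rule compact_superlevel[OF \<epsilon>_pos])

lemma compact_D: "compact (D R)"
proof -
  have "closed (K R \<inter> w -` {..R})"
    using cont_w K_subset compact_K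
    by (intro continuous_closed_preimage) (auto intro: continuous_on_subset compact_imp_closed)
  moreover have "D R = K R \<inter> (K R \<inter> w -` {..R})" by (auto simp: D_def K_def)
  ultimately show ?thesis using compact_K compact_Int_closed by metis
qed

lemma cont_F: "continuous_on UNIV F" and cont_F': "continuous_on UNIV F'"
  using dF dF' by (meson DERIV_isCont continuous_at_imp_continuous_on)+

lemma cont_Fw: "continuous_on G (\<lambda>x. F (w x))" and cont_F'w: "continuous_on G (\<lambda>x. F' (w x))"
  and cont_F''w: "continuous_on G (\<lambda>x. F'' (w x))"
  by (rule continuous_on_compose2[OF cont_F cont_w] continuous_on_compose2[OF cont_F' cont_w]
    continuous_on_compose2[OF cont_F'' cont_w], simp)+

text \<open>The squared distance in the ambient space, so that its sublevel sets are extrinsic balls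
  as in the monotonicity formula.\<close>

definition q where "q x0 w0 x = (norm (x - x0))\<^sup>2 + (w x - w0)\<^sup>2"

lemma cont_q: "continuous_on G (q x0 w0)"
  unfolding q_def by (intro continuous_intros cont_w)

text \<open>The field \<open>V\<close> is tested against \<open>F(w) \<psi>(q)\<close> and \<open>S\<close> against \<open>F'(w) \<Xi>(q)\<close> with \<open>\<Xi>' = - \<psi> / 2\<close>.
  The terms containing \<open>F'\<close> cancel in the sum, and the discarded ones have a sign because \<open>F\<close> is
  convex and \<open>\<psi>\<close> is nonincreasing.\<close>

lemma subharmonicity:
  fixes \<psi> \<psi>' :: "real \<Rightarrow> real"
  assumes d\<psi>: "\<And>t. (\<psi> has_real_derivative \<psi>' t) (at t)" and c\<psi>': "continuous_on UNIV \<psi>'"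
    and \<psi>'_nonpos: "\<And>t. \<psi>' t \<le> 0" and \<psi>_nonneg: "\<And>t. 0 \<le> \<psi> t"
    and \<psi>_0: "\<And>t. b\<^sup>2 \<le> t \<Longrightarrow> \<psi> t = 0" and b: "0 < b" "norm x0 + b \<le> R"
  shows "(LINT x:K R|lborel. F (w x) * W x *
      (real CARD('n) * \<psi> (q x0 w0 x) + 2 * q x0 w0 x * \<psi>' (q x0 w0 x))) \<le> 0"
proof -
  let ?q = "q x0 w0" and ?n = "real CARD('n)"
  have c\<psi>: "continuous_on UNIV \<psi>" using d\<psi> by (meson DERIV_isCont continuous_at_imp_continuous_on)
  \<comment> \<open>The factor - 1 / 2 is dictated by the identity \<open>dqS\<close> below: the
    gradient of \<open>q\<close> paired with \<open>S\<close> is twice \<open>p \<bullet> V\<close>,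
    so the two terms with \<open>F' \<psi>\<close> cancel. Normalising at \<open>b\<^sup>2\<close>
    makes \<open>\<Xi>\<close> vanish where \<open>\<psi>\<close> does.\<close>
  obtain \<Xi> where d\<Xi>: "\<And>t. (\<Xi> has_real_derivative - \<psi> t / 2) (at t)" and \<Xi>b: "\<Xi> (b\<^sup>2) = 0"
    using exists_antiderivative[where g = "\<lambda>t. - \<psi> t / 2" and a = "b\<^sup>2"]
      continuous_on_divide[OF continuous_on_minus[OF c\<psi>] continuous_on_const[of UNIV 2]] by auto
  have c\<Xi>: "continuous_on UNIV \<Xi>" using d\<Xi> by (meson DERIV_isCont continuous_at_imp_continuous_on)
  have \<Xi>_0: "\<Xi> t = 0" if "b\<^sup>2 \<le> t" for t
    using antiderivative_const[OF d\<Xi> that] \<psi>_0 \<Xi>b by simp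
  have \<Xi>_nonneg: "0 \<le> \<Xi> t" for t
  proof (cases "b\<^sup>2 \<le> t")
    case False
    have "\<Xi> (b\<^sup>2) \<le> \<Xi> t"
      by (rule DERIV_nonpos_imp_nonincreasing) (use False d\<Xi> \<psi>_nonneg in \<open>auto intro!: exI[of _ "- \<psi> _ / 2"]\<close>)
    then show ?thesis by (simp add: \<Xi>b)
  qed (simp add: \<Xi>_0)
  define dq where "dq x = 2 *\<^sub>R (x - x0) + (2 * (w x - w0)) *\<^sub>R p x" for x
  have dq: "(?q has_derivative (\<lambda>h. dq x \<bullet> h)) (at x)" if x: "x \<in> G" for x
    unfolding q_def[abs_def] dq_def power2_norm_eq_inner
    by (auto intro!: derivative_eq_intros dw[OF x] simp: algebra_simps power2_eq_square inner_commute)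
  \<comment> \<open>This is where \<open>norm x0 + b \<le> R\<close> enters: the radial weights
    vanish outside the ball of radius \<open>R\<close>, so both test functions are supported in
    \<open>K R\<close>.\<close>
  have q_ge: "b\<^sup>2 \<le> ?q x" if "R < norm x" for x
  proof -
    have "b \<le> norm (x - x0)" using norm_triangle_ineq2[of x x0] that b by simp
    then have "b\<^sup>2 \<le> (norm (x - x0))\<^sup>2" using b by (intro power_mono) auto
    then show ?thesis by (simp add: q_def add_increasing2)
  qed
  define f1 where "f1 x = F (w x) * \<psi> (?q x)" for x
  define df1 where "df1 x = (F' (w x) * \<psi> (?q x)) *\<^sub>R p x + (F (w x) * \<psi>' (?q x)) *\<^sub>R dq x" for x
  define f2 where "f2 x = F' (w x) * \<Xi> (?q x)" for x
  define df2 where "df2 x = (F'' (w x) * \<Xi> (?q x)) *\<^sub>R p x + (F' (w x) * (- \<psi> (?q x) / 2)) *\<^sub>R dq x" for x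
  have comp: "((\<lambda>x. g (h x)) has_derivative (\<lambda>y. (g' (h x) *\<^sub>R dh) \<bullet> y)) (at x)"
    if "\<And>t. (g has_real_derivative g' t) (at t)" "(h has_derivative (\<lambda>y. dh \<bullet> y)) (at x)"
    for g g' h dh and x :: "real^'n"
    using has_derivative_compose[OF that(2) that(1)[THEN has_field_derivative_imp_has_derivative]] by simp
  have df1: "(f1 has_derivative (\<lambda>h. df1 x \<bullet> h)) (at x)" if x: "x \<in> G" for x
    using has_derivative_mult[OF comp[OF dF dw[OF x]] comp[OF d\<psi> dq[OF x]]]
    unfolding f1_def df1_def by (simp add: inner_add_left algebra_simps)
  have df2: "(f2 has_derivative (\<lambda>h. df2 x \<bullet> h)) (at x)" if x: "x \<in> G" for x
    using has_derivative_mult[OF comp[OF dF' dw[OF x]] comp[OF d\<Xi> dq[OF x]]]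
    unfolding f2_def df2_def by (simp add: inner_add_left algebra_simps)
  have c\<psi>q: "continuous_on G (\<lambda>x. \<psi> (?q x))" and c\<psi>'q: "continuous_on G (\<lambda>x. \<psi>' (?q x))"
    and c\<Xi>q: "continuous_on G (\<lambda>x. \<Xi> (?q x))"
    by (rule continuous_on_compose2[OF c\<psi> cont_q] continuous_on_compose2[OF c\<psi>' cont_q]
      continuous_on_compose2[OF c\<Xi> cont_q], simp)+
  have cdq: "continuous_on G dq" unfolding dq_def by (intro continuous_intros cont_w cont_p)
  have cdf1: "continuous_on G df1" unfolding df1_def
    by (intro continuous_intros cont_Fw cont_F'w c\<psi>q c\<psi>'q cdq cont_p)
  have cdf2: "continuous_on G df2" unfolding df2_def
    by (intro continuous_intros cont_F'w cont_F''w c\<psi>q c\<Xi>q cdq cont_p) simp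
  have off: "f1 x = 0" "f2 x = 0" if "x \<in> G - K R" for x
    using that q_ge[of x] F_0[of "w x"] F'_0[of "w x"] \<psi>_0 \<Xi>_0
    by (auto simp: K_def f1_def f2_def not_le)
  have i1: "(LINT x:K R|lborel. df1 x \<bullet> V x0 w0 x + f1 x * (?n * W x)) = 0"
    by (rule integral_test_V[OF compact_K K_subset off(1) df1 cdf1])
  have i2: "(LINT x:K R|lborel. df2 x \<bullet> S x) = 0"
    by (rule integral_test_S[OF compact_K K_subset off(2) df2 cdf2])
  define lhs where "lhs x = F (w x) * W x * (?n * \<psi> (?q x) + 2 * ?q x * \<psi>' (?q x))" for x
  have le: "lhs x \<le> (df1 x \<bullet> V x0 w0 x + f1 x * (?n * W x)) + df2 x \<bullet> S x" if x: "x \<in> G" for x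
  proof -
    define u m where "u = w x - w0" and "m = (x - x0) \<bullet> p x"
    have W: "W x > 0" by (rule W_pos)
    have pp: "p x \<bullet> p x = (W x)\<^sup>2 - 1"
      using area_factor_square[of "p x"] by (simp add: power2_norm_eq_inner)
    have pS: "p x \<bullet> S x = ((W x)\<^sup>2 - 1) / W x" by (simp add: S_def pp)
    have yS: "(x - x0) \<bullet> S x = m / W x" by (simp add: S_def m_def)
    have pV: "p x \<bullet> V x0 w0 x = W x * m + (u - m) * (((W x)\<^sup>2 - 1) / W x)"
      by (simp add: V_def inner_add_right pS u_def m_def inner_commute)
    have yV: "(x - x0) \<bullet> V x0 w0 x = W x * (norm (x - x0))\<^sup>2 + (u - m) * (m / W x)"
      by (simp only: V_def inner_add_right inner_scaleR_right yS u_def[symmetric] m_def[symmetric] power2_norm_eq_inner)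
    have dqS: "dq x \<bullet> S x = 2 * (p x \<bullet> V x0 w0 x)"
      unfolding dq_def inner_add_left inner_scaleR_left yS pS pV u_def[symmetric]
      using W by (simp add: field_simps power2_eq_square)
    \<comment> \<open>Pythagoras: the squared tangential part of the position vector is
      \<open>q\<close> minus the square of its normal component \<open>(u - m) / W x\<close>. The
      latter is the first term to be discarded.\<close>
    have dqV: "dq x \<bullet> V x0 w0 x = 2 * (W x * ?q x - (u - m)\<^sup>2 / W x)"
      unfolding dq_def inner_add_left inner_scaleR_left yV pV u_def[symmetric] q_def
      using W by (simp add: field_simps power2_eq_square)
    have "(df1 x \<bullet> V x0 w0 x + f1 x * (?n * W x)) + df2 x \<bullet> S x
        = lhs x + (2 * F (w x) * (- \<psi>' (?q x)) * ((u - m)\<^sup>2 / W x) + F'' (w x) * \<Xi> (?q x) * ((norm (p x))\<^sup>2 / W x))"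
      unfolding df1_def df2_def inner_add_left inner_scaleR_left dqS dqV
      by (simp add: f1_def lhs_def pS pp power2_norm_eq_inner algebra_simps)
    moreover have "0 \<le> 2 * F (w x) * (- \<psi>' (?q x)) * ((u - m)\<^sup>2 / W x)"
      using F_nonneg \<psi>'_nonpos W by (intro mult_nonneg_nonneg) auto
    moreover have "0 \<le> F'' (w x) * \<Xi> (?q x) * ((norm (p x))\<^sup>2 / W x)"
      using F''_nonneg \<Xi>_nonneg W by (intro mult_nonneg_nonneg) auto
    ultimately show ?thesis by linarith
  qed
  have int1: "set_integrable lborel (K R) (\<lambda>x. df1 x \<bullet> V x0 w0 x + f1 x * (?n * W x))"
    unfolding f1_def
    by (intro set_integrable_compact_continuous compact_K continuous_on_subset[OF _ K_subset]
        continuous_intros cdf1 cont_V cont_Fw c\<psi>q cont_p)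
  have int2: "set_integrable lborel (K R) (\<lambda>x. df2 x \<bullet> S x)"
    by (intro set_integrable_compact_continuous compact_K continuous_on_subset[OF _ K_subset]
        continuous_intros cdf2 cont_S)
  have int3: "set_integrable lborel (K R) lhs"
    unfolding lhs_def
    by (intro set_integrable_compact_continuous compact_K continuous_on_subset[OF _ K_subset]
        continuous_intros cont_Fw c\<psi>q c\<psi>'q cont_p cont_q)
  have "(LINT x:K R|lborel. lhs x)
      \<le> (LINT x:K R|lborel. (df1 x \<bullet> V x0 w0 x + f1 x * (?n * W x)) + df2 x \<bullet> S x)"
    by (rule set_integral_mono[OF int3 set_integral_add(1)[OF int1 int2]]) (use le K_subset in blast)
  also have "\<dots> = 0" using set_integral_add(2)[OF int1 int2] i1 i2 by simp
  finally show ?thesis unfolding lhs_def .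
qed

text \<open>The monotonicity formula with a smooth weight: for the averaged weight of
  \<open>exists_scale_average\<close> the integrand in \<open>subharmonicity\<close> is the
  difference of the two scaled integrands.\<close>

lemma scaled_mass_mono:
  assumes d\<gamma>: "\<And>t. (\<gamma> has_real_derivative \<gamma>' t) (at t)" and c\<gamma>': "continuous_on UNIV \<gamma>'"
    and "\<And>t. \<gamma>' t \<le> 0" "\<And>t. 0 \<le> \<gamma> t" "\<And>t. 1 \<le> t \<Longrightarrow> \<gamma> t = 0"
    and ab: "0 < a" "a < b" "norm x0 + b \<le> R"
  shows "(LINT x:K R|lborel. F (w x) * W x * \<gamma> (q x0 w0 x / a\<^sup>2)) / a ^ CARD('n)
    \<le> (LINT x:K R|lborel. F (w x) * W x * \<gamma> (q x0 w0 x / b\<^sup>2)) / b ^ CARD('n)"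
proof -
  let ?q = "q x0 w0" and ?n = "CARD('n)"
  have c\<gamma>: "continuous_on UNIV \<gamma>" using d\<gamma> by (meson DERIV_isCont continuous_at_imp_continuous_on)
  obtain \<psi> \<psi>' where \<psi>: "\<And>t. (\<psi> has_real_derivative \<psi>' t) (at t)" "continuous_on UNIV \<psi>'"
    "\<And>t. \<psi>' t \<le> 0" "\<And>t. 0 \<le> \<psi> t" "\<And>t. b\<^sup>2 \<le> t \<Longrightarrow> \<psi> t = 0"
    and eq: "\<And>t. real ?n * \<psi> t + 2 * t * \<psi>' t = \<gamma> (t / a\<^sup>2) / a ^ ?n - \<gamma> (t / b\<^sup>2) / b ^ ?n"
    using exists_scale_average[where a = a and b = b and n = ?n, OF ab(1,2) assms(1-5)] by metis
  have int: "set_integrable lborel (K R) (\<lambda>x. F (w x) * W x * \<gamma> (?q x / c\<^sup>2) / c ^ ?n)" if "c \<noteq> 0" for c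
    using that
    by (intro set_integrable_compact_continuous compact_K continuous_on_subset[OF _ K_subset]
        continuous_intros cont_Fw cont_p cont_q continuous_on_compose2[OF c\<gamma>]) auto
  have "(LINT x:K R|lborel. F (w x) * W x * (real ?n * \<psi> (?q x) + 2 * ?q x * \<psi>' (?q x))) \<le> 0"
    using subharmonicity[OF \<psi>(1-5)] ab by simp
  then have "(LINT x:K R|lborel. F (w x) * W x * \<gamma> (?q x / a\<^sup>2) / a ^ ?n - F (w x) * W x * \<gamma> (?q x / b\<^sup>2) / b ^ ?n) \<le> 0"
    unfolding eq by (simp add: right_diff_distrib)
  then show ?thesis
    using set_integral_diff(2)[OF int int, of a b] ab by simp
qed

end

section \<open>Density at a point and the mean value inequality\<close>

context truncated_minimal_graph begin

text \<open>Blow-up at \<open>x0\<close>: after the substitution \<open>x = x0 + a k y\<close> the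
  graph converges to its tangent plane, and \<open>tilted_integral_eq\<close> shows that the limit
  does not depend on the slope.\<close>

lemma scaled_mass_tendsto:
  assumes d\<gamma>: "\<And>t. (\<gamma> has_real_derivative \<gamma>' t) (at t)" and c\<gamma>': "continuous_on UNIV \<gamma>'"
    and \<gamma>_nonneg: "\<And>t. 0 \<le> \<gamma> t" and \<gamma>_le1: "\<And>t. \<gamma> t \<le> 1" and \<gamma>_0: "\<And>t. 1 \<le> t \<Longrightarrow> \<gamma> t = 0"
    and x0: "x0 \<in> G" "\<epsilon> < w x0" "norm x0 < R"
    and a: "\<And>k. 0 < a k" "a \<longlonglongrightarrow> 0"
  shows "(\<lambda>k. (LINT x:K R|lborel. F (w x) * W x * \<gamma> (q x0 (w x0) x / (a k)\<^sup>2)) / a k ^ CARD('n))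
    \<longlonglongrightarrow> F (w x0) * (\<integral>y. \<gamma> ((norm (y :: real^'n))\<^sup>2) \<partial>lborel)"
proof -
  let ?q = "q x0 (w x0)"
  have c\<gamma>: "continuous_on UNIV \<gamma>" using d\<gamma> by (meson DERIV_isCont continuous_at_imp_continuous_on)
  have cg: "continuous_on (K R) (\<lambda>x. F (w x) * W x)"
    by (intro continuous_on_subset[OF _ K_subset] continuous_intros cont_Fw cont_p)
  then have "bounded ((\<lambda>x. F (w x) * W x) ` K R)"
    using compact_K compact_continuous_image compact_imp_bounded by blast
  then obtain M where M: "0 < M" "\<And>x. x \<in> K R \<Longrightarrow> \<bar>F (w x) * W x\<bar> \<le> M"
    by (auto simp: bounded_pos)
  define g where "g k x = indicator (K R) x * (F (w x) * W x * \<gamma> (?q x / (a k)\<^sup>2))" for k x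
  have g_meas [measurable]: "g k \<in> borel_measurable borel" for k
  proof -
    have "set_integrable lborel (K R) (\<lambda>x. F (w x) * W x * \<gamma> (?q x / (a k)\<^sup>2))"
      using a(1)[of k]
      by (intro set_integrable_compact_continuous compact_K continuous_on_subset[OF _ K_subset]
          continuous_intros cont_Fw cont_p cont_q continuous_on_compose2[OF c\<gamma>]) auto
    then have "integrable lborel (g k)"
      unfolding set_integrable_def g_def[abs_def] by simp
    then show ?thesis using borel_measurable_integrable by fastforce
  qed
  have subst: "(LINT x:K R|lborel. F (w x) * W x * \<gamma> (?q x / (a k)\<^sup>2)) / a k ^ CARD('n)
      = (\<integral>y. g k (x0 + a k *\<^sub>R y) \<partial>lborel)" for k
    using lborel_integral_affine[OF g_meas a(1), of k k x0] a(1)[of k]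
    by (simp add: set_lebesgue_integral_def g_def)
  have q_scaled: "?q (x0 + a k *\<^sub>R y) / (a k)\<^sup>2 = (norm y)\<^sup>2 + ((w (x0 + a k *\<^sub>R y) - w x0) / a k)\<^sup>2" for k y
    using a(1)[of k] by (simp add: q_def power_mult_distrib power_divide add_divide_distrib)
  have "(\<lambda>k. \<integral>y. g k (x0 + a k *\<^sub>R y) \<partial>lborel)
      \<longlonglongrightarrow> (\<integral>y. F (w x0) * (W x0 * \<gamma> ((norm y)\<^sup>2 + (p x0 \<bullet> y)\<^sup>2)) \<partial>lborel)"
  \<comment> \<open>The horizontal part of the distance alone confines the support to
    \<open>norm y \<le> 1\<close>, whence a bound independent of \<open>k\<close>.\<close>
  proof (rule integral_dominated_convergence[where w = "\<lambda>y. indicator (cball 0 1) y *\<^sub>R M"])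
    have "continuous_on UNIV (\<lambda>y. F (w x0) * (W x0 * \<gamma> ((norm y)\<^sup>2 + (p x0 \<bullet> y)\<^sup>2)))"
      by (intro continuous_intros continuous_on_compose2[OF c\<gamma>]) auto
    then show "(\<lambda>y. F (w x0) * (W x0 * \<gamma> ((norm y)\<^sup>2 + (p x0 \<bullet> y)\<^sup>2))) \<in> borel_measurable lborel"
      using borel_measurable_continuous_onI by auto
    show "(\<lambda>y. g k (x0 + a k *\<^sub>R y)) \<in> borel_measurable lborel" for k
      by measurable
    show "integrable lborel (\<lambda>y. indicator (cball 0 1) y *\<^sub>R M :: real)"
      by (rule borel_integrable_compact) auto
    show "AE y in lborel. norm (g k (x0 + a k *\<^sub>R y)) \<le> indicator (cball 0 1) y *\<^sub>R M" for k
    proof (rule AE_I2)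
      fix y :: "real^'n"
      let ?x = "x0 + a k *\<^sub>R y"
      show "norm (g k ?x) \<le> indicator (cball 0 1) y *\<^sub>R M"
      proof (cases "?x \<in> K R \<and> norm y \<le> 1")
        case True
        have "\<bar>F (w ?x) * W ?x\<bar> * \<bar>\<gamma> (?q ?x / (a k)\<^sup>2)\<bar> \<le> M * 1"
          using M True \<gamma>_nonneg \<gamma>_le1 by (intro mult_mono) auto
        then show ?thesis using True by (simp add: g_def abs_mult)
      next
        case False
        have "\<gamma> (?q ?x / (a k)\<^sup>2) = 0" if "1 < norm y"
        proof (rule \<gamma>_0)
          have "1 \<le> (norm y)\<^sup>2" using that by (simp add: one_le_power)
          then show "1 \<le> ?q ?x / (a k)\<^sup>2" unfolding q_scaled by (simp add: add_increasing2)
        qed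
        then have "g k ?x = 0" using False by (auto simp: g_def not_le)
        then show ?thesis using M by (simp add: indicator_def)
      qed
    qed
    show "AE y in lborel. (\<lambda>k. g k (x0 + a k *\<^sub>R y)) \<longlonglongrightarrow> F (w x0) * (W x0 * \<gamma> ((norm y)\<^sup>2 + (p x0 \<bullet> y)\<^sup>2))"
    proof (rule AE_I2)
      fix y :: "real^'n"
      let ?x = "\<lambda>k. x0 + a k *\<^sub>R y"
      have lim_x: "?x \<longlonglongrightarrow> x0"
        using tendsto_add[OF tendsto_const[of x0] tendsto_scaleR[OF a(2) tendsto_const[of y]]] by simp
      have iw: "isCont w x0" using dw[OF x0(1)] has_derivative_continuous by blast
      have ip: "isCont p x0" using dp[OF x0(1)] has_derivative_continuous by blast
      have lim_w: "(\<lambda>k. w (?x k)) \<longlonglongrightarrow> w x0" using isCont_tendsto_compose[OF iw lim_x] .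
      have lim_p: "(\<lambda>k. p (?x k)) \<longlonglongrightarrow> p x0" using isCont_tendsto_compose[OF ip lim_x] .
      have "isCont F (w x0)" using dF DERIV_isCont by blast
      from isCont_tendsto_compose[OF this lim_w] have lim_F: "(\<lambda>k. F (w (?x k))) \<longlonglongrightarrow> F (w x0)" .
      have lim_W: "(\<lambda>k. W (?x k)) \<longlonglongrightarrow> W x0"
        unfolding area_factor_def by (intro tendsto_intros lim_p)
      have "((\<lambda>t. x0 + t *\<^sub>R y) has_derivative (\<lambda>t. t *\<^sub>R y)) (at 0)"
        by (auto intro!: derivative_eq_intros)
      moreover have "(w has_derivative (\<lambda>h. p x0 \<bullet> h)) (at (x0 + 0 *\<^sub>R y))"
        using dw[OF x0(1)] by simp
      ultimately have "((\<lambda>t. w (x0 + t *\<^sub>R y)) has_derivative (\<lambda>t. p x0 \<bullet> (t *\<^sub>R y))) (at 0)"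
        by (rule has_derivative_compose)
      then have "((\<lambda>t. w (x0 + t *\<^sub>R y)) has_real_derivative p x0 \<bullet> y) (at 0)"
        by (simp add: has_field_derivative_def mult_commute_abs)
      then have "((\<lambda>t. (w (x0 + t *\<^sub>R y) - w x0) / t) \<longlongrightarrow> p x0 \<bullet> y) (at 0)"
        by (simp add: has_field_derivative_iff)
      moreover have "filterlim a (at 0) sequentially"
        by (rule filterlim_atI[OF a(2)]) (use a(1) in \<open>auto simp: less_imp_neq[symmetric]\<close>)
      ultimately have lim_quot: "(\<lambda>k. (w (?x k) - w x0) / a k) \<longlonglongrightarrow> p x0 \<bullet> y"
        by (rule filterlim_compose)
      have "(\<lambda>k. (norm y)\<^sup>2 + ((w (?x k) - w x0) / a k)\<^sup>2) \<longlonglongrightarrow> (norm y)\<^sup>2 + (p x0 \<bullet> y)\<^sup>2"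
        by (intro tendsto_intros lim_quot)
      then have lim_q: "(\<lambda>k. ?q (?x k) / (a k)\<^sup>2) \<longlonglongrightarrow> (norm y)\<^sup>2 + (p x0 \<bullet> y)\<^sup>2"
        unfolding q_scaled .
      have "isCont \<gamma> t" for t using d\<gamma> DERIV_isCont by blast
      from isCont_tendsto_compose[OF this lim_q]
      have lim_\<gamma>: "(\<lambda>k. \<gamma> (?q (?x k) / (a k)\<^sup>2)) \<longlonglongrightarrow> \<gamma> ((norm y)\<^sup>2 + (p x0 \<bullet> y)\<^sup>2)" .
      have "eventually (\<lambda>k. ?x k \<in> G) sequentially"
        using topological_tendstoD[OF lim_x open_G x0(1)] .
      moreover have "eventually (\<lambda>k. \<epsilon> < w (?x k)) sequentially"
        using order_tendstoD(1)[OF lim_w x0(2)] .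
      moreover have "eventually (\<lambda>k. norm (?x k) < R) sequentially"
        using order_tendstoD(2)[OF tendsto_norm[OF lim_x] x0(3)] .
      ultimately have ev: "eventually (\<lambda>k. F (w (?x k)) * (W (?x k) * \<gamma> (?q (?x k) / (a k)\<^sup>2)) = g k (?x k)) sequentially"
        by eventually_elim (simp add: g_def K_def)
      have "(\<lambda>k. F (w (?x k)) * (W (?x k) * \<gamma> (?q (?x k) / (a k)\<^sup>2)))
          \<longlonglongrightarrow> F (w x0) * (W x0 * \<gamma> ((norm y)\<^sup>2 + (p x0 \<bullet> y)\<^sup>2))"
        by (intro tendsto_mult lim_F lim_W lim_\<gamma>)
      from Lim_transform_eventually[OF this ev]
      show "(\<lambda>k. g k (?x k)) \<longlonglongrightarrow> F (w x0) * (W x0 * \<gamma> ((norm y)\<^sup>2 + (p x0 \<bullet> y)\<^sup>2))" .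
    qed
  qed
  also have "(\<integral>y. F (w x0) * (W x0 * \<gamma> ((norm y)\<^sup>2 + (p x0 \<bullet> y)\<^sup>2)) \<partial>lborel)
      = F (w x0) * (\<integral>y. \<gamma> ((norm (y :: real^'n))\<^sup>2) \<partial>lborel)"
    using tilted_integral_eq[OF d\<gamma> c\<gamma>' \<gamma>_0, of "p x0"] by (simp add: area_factor_def)
  finally show ?thesis unfolding subst .
qed

lemma D_integrable: "set_integrable lborel (D R) (\<lambda>x. F (w x) * W x)" "set_integrable lborel (D R) W"
  by (intro set_integrable_compact_continuous compact_D continuous_on_subset[OF _ D_subset]
      continuous_intros cont_Fw cont_p)+

lemma mean_value:
  assumes x0: "x0 \<in> G" "norm x0 \<le> R" "w x0 \<le> R" and r: "0 < r"
  shows "F (w x0) * (unit_ball_vol (real CARD('n)) * r ^ CARD('n)) \<le> mass (R + r)"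
proof (cases "w x0 \<le> \<epsilon>")
  case True
  have "0 \<le> mass (R + r)"
    unfolding mass_def set_lebesgue_integral_def
    by (rule Bochner_Integration.integral_nonneg)
      (use F_nonneg less_imp_le[OF W_pos] in \<open>auto simp: indicator_def\<close>)
  then show ?thesis using F_0[OF True] by simp
next
  case False
  let ?q = "q x0 (w x0)" and ?n = "CARD('n)" and ?\<omega> = "unit_ball_vol (real CARD('n))"
  \<comment> \<open>A smooth weight supported in the unit ball is only known to be 1 on the ball of
    radius \<theta>, which costs \<open>\<theta> ^ n\<close>. At the end this factor is an arbitrary
    \<open>z\<close> below 1, with \<theta> its n-th root.\<close>
  have key: "\<theta> ^ ?n * (F (w x0) * (?\<omega> * r ^ ?n)) \<le> mass (R + r)" if \<theta>: "0 < \<theta>" "\<theta> < 1" for \<theta>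
  proof -
    have "\<theta>\<^sup>2 < 1" using \<theta> by (simp add: power_less_one_iff)
    then obtain s s' where s: "\<And>t. (s has_real_derivative s' t) (at t)" "continuous_on UNIV s'"
      "\<And>t. 0 \<le> s' t" "\<And>t. t \<le> \<theta>\<^sup>2 \<Longrightarrow> s t = 0" "\<And>t. 1 \<le> t \<Longrightarrow> s t = 1"
      "\<And>t. 0 \<le> s t" "\<And>t. s t \<le> 1"
      using exists_smooth_step[of "\<theta>\<^sup>2" 1] by metis
    define \<gamma> where "\<gamma> t = 1 - s t" for t
    have \<gamma>: "\<And>t. (\<gamma> has_real_derivative - s' t) (at t)" "continuous_on UNIV (\<lambda>t. - s' t)"
      "\<And>t. - s' t \<le> 0" "\<And>t. 0 \<le> \<gamma> t" "\<And>t. 1 \<le> t \<Longrightarrow> \<gamma> t = 0" "\<And>t. \<gamma> t \<le> 1" "\<And>t. t \<le> \<theta>\<^sup>2 \<Longrightarrow> \<gamma> t = 1"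
      using s unfolding \<gamma>_def by (auto intro!: derivative_eq_intros continuous_intros)
    have c\<gamma>: "continuous_on UNIV \<gamma>" using \<gamma>(1) by (meson DERIV_isCont continuous_at_imp_continuous_on)
    define J where "J a = (LINT x:K (R + r)|lborel. F (w x) * W x * \<gamma> (?q x / a\<^sup>2)) / a ^ ?n" for a
    define I where "I = (\<integral>y. \<gamma> ((norm (y :: real^'n))\<^sup>2) \<partial>lborel)"
    \<comment> \<open>Starting at \<open>r / 2\<close> keeps every scale strictly below
      \<open>r\<close>, as the comparison of scales requires.\<close>
    define a where "a k = r / real (Suc (Suc k))" for k
    have a: "\<And>k. 0 < a k" "\<And>k. a k < r" using r by (auto simp: a_def field_simps add_pos_nonneg)
    have "a \<longlonglongrightarrow> 0"
      using tendsto_mult[OF tendsto_const[of r] LIMSEQ_Suc[OF LIMSEQ_Suc[OF lim_1_over_n]]]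
      by (simp add: a_def[abs_def])
    then have lim: "(\<lambda>k. J (a k)) \<longlonglongrightarrow> F (w x0) * I"
      unfolding J_def I_def
      using False x0 r a by (intro scaled_mass_tendsto[OF \<gamma>(1,2,4,6,5)]) auto
    have J_le: "J (a k) \<le> J r" for k
      unfolding J_def using x0 a by (intro scaled_mass_mono[OF \<gamma>(1-5)]) auto
    have "F (w x0) * I \<le> J r"
      by (rule LIMSEQ_le_const2[OF lim]) (use J_le in blast)
    moreover have "J r * r ^ ?n \<le> mass (R + r)"
    proof -
      have "J r * r ^ ?n = (LINT x:K (R + r)|lborel. F (w x) * W x * \<gamma> (?q x / r\<^sup>2))"
        using r by (simp add: J_def)
      also have "\<dots> \<le> mass (R + r)"
        unfolding mass_def set_lebesgue_integral_def
      proof (rule integral_mono)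
        show "integrable lborel (\<lambda>x. indicator (K (R + r)) x *\<^sub>R (F (w x) * W x * \<gamma> (?q x / r\<^sup>2)))"
          unfolding set_integrable_def[symmetric]
          using r by (intro set_integrable_compact_continuous compact_K continuous_on_subset[OF _ K_subset]
              continuous_intros cont_Fw cont_p cont_q continuous_on_compose2[OF c\<gamma>]) auto
        show "integrable lborel (\<lambda>x. indicator (D (R + r)) x *\<^sub>R (F (w x) * W x))"
          using D_integrable(1) unfolding set_integrable_def .
        fix x
        have nn: "0 \<le> F (w x) * W x" using F_nonneg W_pos[of x] by simp
        show "indicator (K (R + r)) x *\<^sub>R (F (w x) * W x * \<gamma> (?q x / r\<^sup>2))
            \<le> indicator (D (R + r)) x *\<^sub>R (F (w x) * W x)"
        \<comment> \<open>A point of \<open>K (R + r)\<close> outside \<open>D (R + r)\<close> lies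
          above height \<open>R + r\<close>, hence more than \<open>r\<close> above
          \<open>w x0\<close>, where the weight vanishes.\<close>
        proof (cases "x \<in> K (R + r) \<and> x \<notin> D (R + r)")
          case True
          then have "R + r < w x" by (auto simp: K_def D_def)
          then have "r < w x - w x0" using x0 by linarith
          then have "r\<^sup>2 \<le> (w x - w x0)\<^sup>2" using r by (intro power_mono) auto
          then have "1 \<le> ?q x / r\<^sup>2" using r by (simp add: q_def add_increasing)
          then show ?thesis using True \<gamma>(5) nn by (simp add: indicator_def)
        next
          case False
          have "F (w x) * W x * \<gamma> (?q x / r\<^sup>2) \<le> F (w x) * W x * 1"
            using nn \<gamma>(6) by (intro mult_left_mono) auto
          then show ?thesis using False D_subset_K[of "R + r"] nn by (auto simp: indicator_def)
        qed
      qed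
      finally show ?thesis .
    qed
    moreover have "?\<omega> * \<theta> ^ ?n \<le> I"
    proof -
      have supp: "\<gamma> ((norm y)\<^sup>2) = indicator (cball 0 1) y *\<^sub>R \<gamma> ((norm y)\<^sup>2)" for y :: "real^'n"
        using \<gamma>(5)[of "(norm y)\<^sup>2"] by (auto simp: indicator_def one_le_power)
      have "?\<omega> * \<theta> ^ ?n = measure lborel (cball (0 :: real^'n) \<theta>)"
        using content_cball[of \<theta> "0 :: real^'n"] \<theta> by simp
      also have "\<dots> = (\<integral>y. indicator (cball (0 :: real^'n) \<theta>) y \<partial>lborel)" by simp
      also have "\<dots> \<le> I"
        unfolding I_def
      proof (rule integral_mono)
        show "integrable lborel (indicator (cball (0 :: real^'n) \<theta>) :: _ \<Rightarrow> real)"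
          using borel_integrable_compact[of "cball (0 :: real^'n) \<theta>" "\<lambda>_. 1 :: real"] by simp
        show "integrable lborel (\<lambda>y :: real^'n. \<gamma> ((norm y)\<^sup>2))"
          by (subst supp, rule borel_integrable_compact)
            (auto intro!: continuous_on_compose2[OF c\<gamma>] continuous_intros)
        show "indicator (cball 0 \<theta>) y \<le> \<gamma> ((norm y)\<^sup>2)" for y :: "real^'n"
          using \<gamma>(4) \<gamma>(7)[of "(norm y)\<^sup>2"] by (auto simp: indicator_def power_mono)
      qed
      finally show ?thesis .
    qed
    moreover from this have "F (w x0) * (?\<omega> * \<theta> ^ ?n) \<le> F (w x0) * I"
      using F_nonneg by (intro mult_left_mono)
    ultimately have "F (w x0) * (?\<omega> * \<theta> ^ ?n) \<le> J r" and le: "J r * r ^ ?n \<le> mass (R + r)" by linarith+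
    then have "F (w x0) * (?\<omega> * \<theta> ^ ?n) * r ^ ?n \<le> J r * r ^ ?n"
      using r by (intro mult_right_mono) auto
    with le show ?thesis by (simp add: mult_ac)
  qed
  show ?thesis
  proof (rule field_le_mult_one_interval)
    fix z :: real assume z: "0 < z" "z < 1"
    have "root ?n z ^ ?n = z" using z by simp
    moreover have "0 < root ?n z" "root ?n z < 1" using z by auto
    ultimately show "z * (F (w x0) * (?\<omega> * r ^ ?n)) \<le> mass (R + r)" using key by metis
  qed
qed

lemma mass_le_area: "mass R \<le> R * area R"
proof -
  have "mass R \<le> (LINT x:D R|lborel. R * W x)"
    unfolding mass_def
  proof (rule set_integral_mono[OF D_integrable(1)])
    show "set_integrable lborel (D R) (\<lambda>x. R * W x)" using D_integrable(2) by simp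
    fix x assume "x \<in> D R"
    then have "F (w x) \<le> R" using F_le[of "w x"] w_nonneg[of x] by (auto simp: D_def)
    then show "F (w x) * W x \<le> R * W x" using W_pos[of x] by (intro mult_right_mono) auto
  qed
  then show ?thesis by (simp add: area_def)
qed

lemma mass_growth:
  assumes r: "0 < r"
  shows "mass R * (unit_ball_vol (real CARD('n)) * r ^ CARD('n)) \<le> mass (R + r) * area R"
proof -
  let ?c = "unit_ball_vol (real CARD('n)) * r ^ CARD('n)"
  have "mass R * ?c = (LINT x:D R|lborel. ?c * (F (w x) * W x))"
    by (simp add: mass_def mult.commute)
  also have "\<dots> \<le> (LINT x:D R|lborel. mass (R + r) * W x)"
  proof (rule set_integral_mono)
    show "set_integrable lborel (D R) (\<lambda>x. ?c * (F (w x) * W x))" using D_integrable(1) by simp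
    show "set_integrable lborel (D R) (\<lambda>x. mass (R + r) * W x)" using D_integrable(2) by simp
    fix x assume "x \<in> D R"
    then have "F (w x) * ?c \<le> mass (R + r)" using r by (intro mean_value) (auto simp: D_def)
    then have "F (w x) * ?c * W x \<le> mass (R + r) * W x" using W_pos[of x] by (intro mult_right_mono) auto
    then show "?c * (F (w x) * W x) \<le> mass (R + r) * W x" by (simp add: mult_ac)
  qed
  also have "\<dots> = mass (R + r) * area R" by (simp add: area_def)
  finally show ?thesis .
qed

end

section \<open>Area growth\<close>

text \<open>The gradient is carried along as data: a single pair is tested on all the graphs, so
  that their area bounds can be added.\<close>

definition cutoff :: "real \<Rightarrow> real \<Rightarrow> (real^'n \<Rightarrow> real) \<Rightarrow> (real^'n \<Rightarrow> real^'n) \<Rightarrow> bool" where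
  "cutoff R R2 \<eta> \<eta>' \<longleftrightarrow> (\<forall>x. (\<eta> has_derivative (\<lambda>h. \<eta>' x \<bullet> h)) (at x)) \<and> continuous_on UNIV \<eta>'
    \<and> (\<forall>x. 0 \<le> \<eta> x \<and> \<eta> x \<le> 1) \<and> (\<forall>x. norm x \<le> R \<longrightarrow> \<eta> x = 1)
    \<and> (\<forall>x. R2 \<le> norm x \<longrightarrow> \<eta> x = 0 \<and> \<eta>' x = 0)"

lemma cutoff_integrable:
  fixes \<eta> :: "real^'n \<Rightarrow> real"
  assumes "cutoff R R2 \<eta> \<eta>'"
  shows "integrable lborel (\<lambda>x. norm (\<eta>' x))"
proof -
  have "continuous_on UNIV \<eta>'" using assms unfolding cutoff_def by blast
  then have "continuous_on (cball 0 R2) (\<lambda>x. norm (\<eta>' x))"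
    by (intro continuous_on_norm) (rule continuous_on_subset, auto)
  then have "integrable lborel (\<lambda>x. indicator (cball 0 R2) x *\<^sub>R norm (\<eta>' x))"
    by (rule borel_integrable_compact[OF compact_cball])
  also have "(\<lambda>x. indicator (cball 0 R2) x *\<^sub>R norm (\<eta>' x)) = (\<lambda>x. norm (\<eta>' x))"
    using assms by (auto simp: cutoff_def indicator_def fun_eq_iff)
  finally show ?thesis .
qed

text \<open>The radial cutoff is tested against the position vector field, whose divergence is the
  dimension; this replaces integration over the sphere.\<close>

lemma exists_cutoff:
  assumes R: "0 < R" "R < R2"
  obtains \<eta> and \<eta>' :: "real^'n \<Rightarrow> real^'n" where "cutoff R R2 \<eta> \<eta>'"
    "R * (\<integral>x. norm (\<eta>' x) \<partial>lborel) \<le> real CARD('n) * (unit_ball_vol (real CARD('n)) * R2 ^ CARD('n))"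
proof -
  have "R\<^sup>2 < R2\<^sup>2" using R by (intro power_strict_mono) auto
  then obtain s s' where s: "\<And>t. (s has_real_derivative s' t) (at t)" "continuous_on UNIV s'"
      "\<And>t. 0 \<le> s' t" "\<And>t. t \<le> R\<^sup>2 \<Longrightarrow> s' t = 0" "\<And>t. R2\<^sup>2 \<le> t \<Longrightarrow> s' t = 0"
      "\<And>t. t \<le> R\<^sup>2 \<Longrightarrow> s t = 0" "\<And>t. R2\<^sup>2 \<le> t \<Longrightarrow> s t = 1" "\<And>t. 0 \<le> s t" "\<And>t. s t \<le> 1"
    by (rule exists_smooth_step) (rule that)
  define \<eta> where "\<eta> x = 1 - s ((norm x)\<^sup>2)" for x :: "real^'n"
  define \<eta>' where "\<eta>' x = - ((2 * s' ((norm x)\<^sup>2)) *\<^sub>R x)" for x :: "real^'n"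
  have d: "(\<eta> has_derivative (\<lambda>h. \<eta>' x \<bullet> h)) (at x)" for x
  proof -
    have "((\<lambda>x. (norm x)\<^sup>2) has_derivative (\<lambda>h. 2 * (x \<bullet> h))) (at x)"
      unfolding power2_norm_eq_inner by (auto intro!: derivative_eq_intros simp: inner_commute)
    from has_derivative_compose[OF this s(1)[THEN has_field_derivative_imp_has_derivative]]
    have "((\<lambda>x. s ((norm x)\<^sup>2)) has_derivative (\<lambda>h. s' ((norm x)\<^sup>2) * (2 * (x \<bullet> h)))) (at x)" .
    from has_derivative_diff[OF has_derivative_const[of 1] this]
    show ?thesis unfolding \<eta>_def[abs_def] \<eta>'_def by (simp add: mult_ac)
  qed
  have c\<eta>': "continuous_on UNIV \<eta>'"
    unfolding \<eta>'_def by (intro continuous_intros continuous_on_compose2[OF s(2)]) auto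
  have cut: "cutoff R R2 \<eta> \<eta>'"
    unfolding cutoff_def
    by (intro conjI allI impI d c\<eta>') (use s(5-9) R in \<open>auto simp: \<eta>_def \<eta>'_def power_mono\<close>)
  then have \<eta>0: "\<eta> x = 0" if "R2 \<le> norm x" for x using that unfolding cutoff_def by blast
  have c\<eta>: "continuous_on UNIV \<eta>"
    using d by (meson continuous_at_imp_continuous_on has_derivative_continuous)
  have dx: "((\<lambda>x. x) has_derivative (\<lambda>h. h)) (at x)" for x :: "real^'n" by simp
  have "(LINT x:cball 0 R2|lborel. \<eta>' x \<bullet> x + \<eta> x * (\<Sum>i\<in>(UNIV :: 'n set). axis i 1 $ i)) = 0"
    by (rule integral_divergence_eq_0[OF open_UNIV compact_cball subset_UNIV _ d dx c\<eta>' continuous_on_const])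
      (use \<eta>0 in auto)
  then have 0: "(LINT x:cball 0 R2|lborel. \<eta>' x \<bullet> x + \<eta> x * real CARD('n)) = 0" by simp
  have i1: "set_integrable lborel (cball 0 R2) (\<lambda>x. - (\<eta>' x \<bullet> x))"
    by (intro set_integrable_compact_continuous compact_cball continuous_intros continuous_on_subset[OF c\<eta>']) auto
  have i2: "set_integrable lborel (cball 0 R2) (\<lambda>x. \<eta> x * real CARD('n))"
    by (intro set_integrable_compact_continuous compact_cball continuous_intros continuous_on_subset[OF c\<eta>]) auto
  have i3: "set_integrable lborel (cball (0 :: real^'n) R2) (\<lambda>x. real CARD('n))"
    by (intro set_integrable_compact_continuous compact_cball continuous_intros)
  \<comment> \<open>The gradient points inward and lives where \<open>norm x \<ge> R\<close>, so
    \<open>R * norm (\<eta>' x)\<close> is at most \<open>- (\<eta>' x \<bullet> x)\<close>, the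
    integrand that the divergence identity evaluates.\<close>
  have "R * (\<integral>x. norm (\<eta>' x) \<partial>lborel) = (\<integral>x. R * norm (\<eta>' x) \<partial>lborel)" by simp
  also have "\<dots> \<le> (LINT x:cball 0 R2|lborel. - (\<eta>' x \<bullet> x))"
    unfolding set_lebesgue_integral_def
  proof (rule integral_mono)
    show "integrable lborel (\<lambda>x. R * norm (\<eta>' x))" using cutoff_integrable[OF cut] by simp
    show "integrable lborel (\<lambda>x. indicator (cball 0 R2) x *\<^sub>R - (\<eta>' x \<bullet> x))"
      using i1 unfolding set_integrable_def .
    fix x :: "real^'n"
    show "R * norm (\<eta>' x) \<le> indicator (cball 0 R2) x *\<^sub>R - (\<eta>' x \<bullet> x)"
    proof (cases "R \<le> norm x \<and> norm x \<le> R2")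
      case True
      have "R * norm (\<eta>' x) = 2 * s' ((norm x)\<^sup>2) * (R * norm x)" using s(3) by (simp add: \<eta>'_def)
      also have "\<dots> \<le> 2 * s' ((norm x)\<^sup>2) * (norm x * norm x)"
        using True s(3) by (intro mult_left_mono mult_right_mono) auto
      also have "\<dots> = - (\<eta>' x \<bullet> x)" by (simp add: \<eta>'_def power2_norm_eq_inner[symmetric] power2_eq_square)
      finally show ?thesis using True by simp
    next
      case False
      then have "(norm x)\<^sup>2 \<le> R\<^sup>2 \<or> R2\<^sup>2 \<le> (norm x)\<^sup>2" using R by (auto simp: power_mono)
      then have "\<eta>' x = 0" using s(4,5) by (auto simp: \<eta>'_def)
      then show ?thesis by simp
    qed
  qed
  also have "\<dots> = (LINT x:cball 0 R2|lborel. \<eta> x * real CARD('n))"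
    using set_integral_diff(2)[OF i2 i1] 0 by (simp add: add.commute)
  also have "\<dots> \<le> (LINT x:cball (0 :: real^'n) R2|lborel. real CARD('n))"
    by (rule set_integral_mono[OF i2 i3]) (use cut in \<open>auto simp: cutoff_def\<close>)
  also have "\<dots> = real CARD('n) * measure lborel (cball (0 :: real^'n) R2)"
    by (simp add: set_lebesgue_integral_def)
  also have "measure lborel (cball (0 :: real^'n) R2) = unit_ball_vol (real CARD('n)) * R2 ^ CARD('n)"
    using content_cball[of R2 "0 :: real^'n"] R by simp
  finally show ?thesis using that[OF cut] by simp
qed

section \<open>Area bound for a single graph\<close>

context truncated_minimal_graph begin

text \<open>The field \<open>S\<close> is tested against \<open>f(w) \<eta>\<close>, where \<open>f\<close> is a smooth version of \<open>min w R\<close>.\<close>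

lemma area_le:
  assumes R: "0 < R" "R < R2" and cut: "cutoff R R2 \<eta> \<eta>'"
  shows "area R \<le> (LINT x:G|lborel. indicator (cball 0 R) x + R2 * norm (\<eta>' x))"
proof -
  have half: "\<epsilon> / 2 < \<epsilon>" using \<epsilon>_pos by simp
  obtain s1 s1' where s1: "\<And>t. (s1 has_real_derivative s1' t) (at t)"
      "\<And>t. t \<le> \<epsilon> / 2 \<Longrightarrow> s1 t = 0" "\<And>t. \<epsilon> \<le> t \<Longrightarrow> s1 t = 1" "\<And>t. 0 \<le> s1 t" "\<And>t. s1 t \<le> 1"
    by (rule exists_smooth_step[OF half]) (rule that)
  obtain s2 s2' where s2: "\<And>t. (s2 has_real_derivative s2' t) (at t)"
      "\<And>t. t \<le> R \<Longrightarrow> s2 t = 0" "\<And>t. R2 \<le> t \<Longrightarrow> s2 t = 1" "\<And>t. 0 \<le> s2 t" "\<And>t. s2 t \<le> 1"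
    by (rule exists_smooth_step[OF R(2)]) (rule that)
  \<comment> \<open>\<open>s1\<close> keeps the test function away from the boundary of
    \<open>G\<close>, \<open>s2\<close> stops its growth at \<open>R2\<close>; between \<epsilon>
    and \<open>R\<close>, the heights occurring in \<open>D R\<close>, the slope is 1.\<close>
  define f' where "f' t = s1 t * (1 - s2 t)" for t
  have "isCont s1 t" "isCont s2 t" for t using s1(1) s2(1) DERIV_isCont by blast+
  then have cf': "continuous_on UNIV f'"
    unfolding f'_def by (intro continuous_at_imp_continuous_on ballI continuous_intros)
  have f': "0 \<le> f' t" "f' t \<le> 1" for t
    using s1(4,5) s2(4,5) by (auto simp: f'_def intro: mult_le_one)
  have f'1: "f' t = 1" if "\<epsilon> \<le> t" "t \<le> R" for t using that s1 s2 by (simp add: f'_def)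
  obtain f where df: "\<And>t. (f has_real_derivative f' t) (at t)" and f0: "f 0 = 0"
    using exists_antiderivative[OF cf'] by metis
  have cf: "continuous_on UNIV f" using df by (meson DERIV_isCont continuous_at_imp_continuous_on)
  have f_eps: "f t = 0" if "0 \<le> t" "t \<le> \<epsilon> / 2" for t
    using antiderivative_const[OF df that(1)] that s1(2) f0 by (simp add: f'_def)
  have f_nonneg: "0 \<le> f t" if "0 \<le> t" for t
    using DERIV_nonneg_imp_nondecreasing[of 0 t f] that df f' f0 by auto
  have f_le_id: "f t \<le> t" if "0 \<le> t" for t
  proof -
    have "f t - t \<le> f 0 - 0"
      by (rule DERIV_nonpos_imp_nonincreasing[OF that, of "\<lambda>t. f t - t"])
        (auto intro!: exI[of _ "f' _ - 1"] derivative_eq_intros df simp: f')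
    then show ?thesis by (simp add: f0)
  qed
  have f_le: "f t \<le> R2" if "0 \<le> t" for t
  proof (cases "t \<le> R2")
    case False
    then have "f R2 = f t" using antiderivative_const[OF df, of R2 t] s2(3) by (simp add: f'_def)
    then show ?thesis using f_le_id[of R2] R by simp
  qed (use f_le_id[OF that] in simp)
  \<comment> \<open>To have slope 1 from \<epsilon> on, \<open>f\<close> must start growing at
    \<epsilon> / 2, so the support reaches below the level of \<open>D R\<close>.\<close>
  define K0 where "K0 = {x \<in> G. norm x \<le> R2 \<and> \<epsilon> / 2 \<le> w x}"
  have K0: "compact K0" "K0 \<subseteq> G"
    unfolding K0_def using compact_superlevel[of "\<epsilon> / 2" R2] \<epsilon>_pos by auto
  define d\<phi> where "d\<phi> x = (f' (w x) * \<eta> x) *\<^sub>R p x + f (w x) *\<^sub>R \<eta>' x" for x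
  have c\<eta>: "continuous_on G \<eta>" and c\<eta>': "continuous_on G \<eta>'"
    using cut unfolding cutoff_def
    by (meson continuous_at_imp_continuous_on has_derivative_continuous, meson continuous_on_subset subset_UNIV)
  have cd\<phi>: "continuous_on G d\<phi>"
    unfolding d\<phi>_def
    by (intro continuous_intros c\<eta> c\<eta>' cont_p continuous_on_compose2[OF cf cont_w] continuous_on_compose2[OF cf' cont_w]) auto
  have d: "((\<lambda>x. f (w x) * \<eta> x) has_derivative (\<lambda>h. d\<phi> x \<bullet> h)) (at x)" if x: "x \<in> G" for x
  proof -
    have "((\<lambda>x. f (w x)) has_derivative (\<lambda>h. f' (w x) * (p x \<bullet> h))) (at x)"
      using has_derivative_compose[OF dw[OF x] df[THEN has_field_derivative_imp_has_derivative]] .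
    from has_derivative_mult[OF this, of \<eta> "\<lambda>h. \<eta>' x \<bullet> h"] show ?thesis
      using cut by (simp add: cutoff_def d\<phi>_def inner_add_left algebra_simps)
  qed
  have off: "f (w x) * \<eta> x = 0" if x: "x \<in> G - K0" for x
  proof (cases "norm x \<le> R2")
    case True
    then have "w x \<le> \<epsilon> / 2" using x by (auto simp: K0_def)
    then show ?thesis using f_eps[OF w_nonneg[of x]] x by simp
  next
    case False
    then have "\<eta> x = 0" using cut by (simp add: cutoff_def)
    then show ?thesis by simp
  qed
  have test: "(LINT x:K0|lborel. d\<phi> x \<bullet> S x) = 0"
    by (rule integral_test_S[OF K0 off d cd\<phi>])
  let ?g = "\<lambda>x. indicator (cball 0 R) x + R2 * norm (\<eta>' x)"
  have g_nonneg: "0 \<le> ?g x" for x using R by simp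
  have int_g: "integrable lborel ?g"
    using cutoff_integrable[OF cut] borel_integrable_compact[of "cball (0 :: real^'n) R" "\<lambda>_. 1 :: real"] by simp
  \<comment> \<open>A calibration estimate. \<open>p x \<bullet> S x\<close> is
    \<open>W x - 1 / W x\<close>, so the area element exceeds it by at most 1, which the indicator
    of the ball pays for (the base of the cylinder). Since \<open>S\<close> has norm at most 1 and
    \<open>f\<close> is at most \<open>R2\<close>, the cutoff term costs
    \<open>R2 * norm (\<eta>' x)\<close> (its side).\<close>
  have lower: "indicator (cball 0 R) x + f' (w x) * \<eta> x * (W x - 1 / W x) \<le> ?g x + d\<phi> x \<bullet> S x"
    and slope: "0 \<le> W x - 1 / W x" "1 / W x \<le> 1" if x: "x \<in> G" for x
  proof -
    have W1: "1 \<le> W x" by (simp add: area_factor_def)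
    then show "1 / W x \<le> 1" by simp
    with W1 show "0 \<le> W x - 1 / W x" by linarith
    have pS: "p x \<bullet> S x = W x - 1 / W x"
      using W1 area_factor_square[of "p x"]
      by (simp add: S_def power2_norm_eq_inner[symmetric] field_simps power2_eq_square)
    have "norm (p x) \<le> W x"
      unfolding area_factor_def by (rule real_le_rsqrt) simp
    then have "norm (S x) \<le> 1" using W1 by (simp add: S_def)
    then have "\<bar>\<eta>' x \<bullet> S x\<bar> \<le> norm (\<eta>' x) * 1"
      by (intro order_trans[OF Cauchy_Schwarz_ineq2] mult_left_mono) auto
    then have "\<bar>f (w x)\<bar> * \<bar>\<eta>' x \<bullet> S x\<bar> \<le> R2 * norm (\<eta>' x)"
      using f_nonneg f_le w_nonneg[OF x] R by (intro mult_mono) auto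
    then have "- (R2 * norm (\<eta>' x)) \<le> f (w x) * (\<eta>' x \<bullet> S x)"
      unfolding abs_mult[symmetric] by linarith
    then show "indicator (cball 0 R) x + f' (w x) * \<eta> x * (W x - 1 / W x) \<le> ?g x + d\<phi> x \<bullet> S x"
      by (simp add: d\<phi>_def inner_add_left pS)
  qed
  have pointwise: "W x \<le> ?g x + d\<phi> x \<bullet> S x" if x: "x \<in> D R" for x
  proof -
    have "x \<in> G" "norm x \<le> R" "f' (w x) = 1" "\<eta> x = 1"
      using x f'1[of "w x"] cut by (auto simp: D_def cutoff_def)
    then show ?thesis using lower[of x] slope[of x] by simp
  qed
  \<comment> \<open>\<open>K0\<close> is larger than \<open>D R\<close>, so the surplus of the
    integral must be nonnegative.\<close>
  have pointwise0: "0 \<le> ?g x + d\<phi> x \<bullet> S x" if x: "x \<in> G" for x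
  proof -
    have "0 \<le> f' (w x) * \<eta> x * (W x - 1 / W x)"
      using f'(1) cut slope[OF x] by (intro mult_nonneg_nonneg) (auto simp: cutoff_def)
    moreover have "(0::real) \<le> indicator (cball 0 R) x" by simp
    ultimately show ?thesis using lower[OF x] by linarith
  qed
  have int_g': "set_integrable lborel X ?g" if "X \<in> sets lborel" for X
    using integrable_mult_indicator[OF that int_g] by (simp add: set_integrable_def)
  have K0_sets: "K0 \<in> sets lborel" using K0(1) by (simp add: borel_compact)
  have G_sets: "G \<in> sets lborel" using open_G by simp
  have int_S: "set_integrable lborel K0 (\<lambda>x. d\<phi> x \<bullet> S x)"
    by (intro set_integrable_compact_continuous K0(1) continuous_on_subset[OF _ K0(2)] continuous_intros cd\<phi> cont_S)
  have "area R \<le> (LINT x:K0|lborel. ?g x + d\<phi> x \<bullet> S x)"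
    unfolding area_def set_lebesgue_integral_def
  proof (rule integral_mono)
    show "integrable lborel (\<lambda>x. indicator (D R) x *\<^sub>R W x)"
      using D_integrable(2) unfolding set_integrable_def .
    show "integrable lborel (\<lambda>x. indicator K0 x *\<^sub>R (?g x + d\<phi> x \<bullet> S x))"
      using set_integral_add(1)[OF int_g'[OF K0_sets] int_S] unfolding set_integrable_def .
    fix x
    have "D R \<subseteq> K0" using R \<epsilon>_pos by (auto simp: D_def K0_def)
    then show "indicator (D R) x *\<^sub>R W x \<le> indicator K0 x *\<^sub>R (?g x + d\<phi> x \<bullet> S x)"
      using pointwise[of x] pointwise0[of x] K0(2) by (auto simp: indicator_def)
  qed
  also have "\<dots> = (LINT x:K0|lborel. ?g x)"
    using set_integral_add(2)[OF int_g'[OF K0_sets] int_S] test by simp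
  also have "\<dots> \<le> (LINT x:G|lborel. ?g x)"
    unfolding set_lebesgue_integral_def
  proof (rule integral_mono)
    show "indicator K0 x *\<^sub>R ?g x \<le> indicator G x *\<^sub>R ?g x" for x
      using g_nonneg[of x] K0(2) by (auto simp: indicator_def)
  qed (use int_g'[OF K0_sets] int_g'[OF G_sets] in \<open>simp_all add: set_integrable_def\<close>)
  finally show ?thesis .
qed

end

section \<open>Admissible domains\<close>

text \<open>Differentiability of every partial derivative makes the gradient differentiable, with
  the Hessian as derivative. Expanding the divergence gives the trace of \<open>H\<close> over
  \<open>W\<close> minus \<open>p \<bullet> H p\<close> over \<open>W^3\<close>; multiplying by
  \<open>W^3\<close> clears the denominators.\<close>

lemma C2_minimal_surface_derivatives:
  fixes G :: "(real^'n) set"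
  assumes G: "open G" and C2: "C2_on G w" and mse: "minimal_surface_eq_on G w"
  obtains p H where "\<And>x. x \<in> G \<Longrightarrow> (w has_derivative (\<lambda>h. p x \<bullet> h)) (at x)"
    "\<And>x. x \<in> G \<Longrightarrow> (p has_derivative H x) (at x)"
    "\<And>i. continuous_on G (\<lambda>x. H x (axis i 1))"
    "\<And>x. x \<in> G \<Longrightarrow> (area_factor (p x))\<^sup>2 * (\<Sum>i\<in>UNIV. H x (axis i 1) $ i) = p x \<bullet> H x (p x)"
proof -
  define H where "H x h = (\<chi> i. frechet_derivative (partial w i) (at x) h)" for x h
  have dw: "(w has_derivative (\<lambda>h. grad w x \<bullet> h)) (at x)" if x: "x \<in> G" for x
  proof -
    have d: "(w has_derivative frechet_derivative w (at x)) (at x)"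
      using C2 x frechet_derivative_works unfolding C2_on_def by blast
    have "frechet_derivative w (at x) h = grad w x \<bullet> h" for h
      using sum_linear_axis[OF has_derivative_linear[OF d], of h]
      by (simp add: grad_def partial_def inner_vec_def)
    then have "frechet_derivative w (at x) = (\<lambda>h. grad w x \<bullet> h)" by blast
    with d show ?thesis by simp
  qed
  have dp: "(grad w has_derivative H x) (at x)" if x: "x \<in> G" for x
  proof -
    have "(partial w i has_derivative frechet_derivative (partial w i) (at x)) (at x)" for i
      using C2 x frechet_derivative_works unfolding C2_on_def by blast
    then show ?thesis
      by (subst has_derivative_componentwise_within)
        (auto simp: Basis_vec_def inner_axis grad_def H_def)
  qed
  have cH: "continuous_on G (\<lambda>x. H x (axis i 1))" for i
    unfolding H_def using C2 unfolding C2_on_def partial_def[symmetric]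
    by (intro continuous_on_vec_lambda) (auto simp: partial_def[abs_def])
  have nondiv: "(area_factor (grad w x))\<^sup>2 * (\<Sum>i\<in>UNIV. H x (axis i 1) $ i) = grad w x \<bullet> H x (grad w x)"
    if x: "x \<in> G" for x
  proof -
    let ?p = "grad w x" and ?W = "area_factor (grad w x)"
    have W: "?W > 0" by (rule area_factor_pos)
    have lin: "linear (H x)" using dp[OF x] has_derivative_linear by blast
    have lin': "linear (\<lambda>h. ?p \<bullet> H x h)"
      by (intro linearI) (auto simp: linear_add[OF lin] linear_cmul[OF lin] inner_add_right)
    have "partial (\<lambda>y. grad w y $ i / sqrt (1 + (norm (grad w y))\<^sup>2)) i x
        = H x (axis i 1) $ i / ?W - (?p \<bullet> H x (axis i 1)) * ?p $ i / ?W ^ 3" for i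
    proof -
      have "((\<lambda>y. area_factor (grad w y)) has_derivative (\<lambda>h. ?p \<bullet> H x h / ?W)) (at x)"
        using has_derivative_compose[OF dp[OF x] has_derivative_area_factor] .
      then have "((\<lambda>y. grad w y $ i / area_factor (grad w y)) has_derivative
          (\<lambda>h. H x h $ i / ?W - (?p \<bullet> H x h) * ?p $ i / ?W ^ 3)) (at x)"
        using W by (auto intro!: derivative_eq_intros dp[OF x] bounded_linear.has_derivative[OF bounded_linear_vec_nth]
            simp: field_simps power2_eq_square power3_eq_cube)
      from frechet_derivative_at[OF this] show ?thesis
        by (simp add: partial_def area_factor_def fun_eq_iff)
    qed
    moreover have "(\<Sum>i\<in>UNIV. partial (\<lambda>y. grad w y $ i / sqrt (1 + (norm (grad w y))\<^sup>2)) i x) = 0"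
      using mse x unfolding minimal_surface_eq_on_def by blast
    ultimately have "0 = (\<Sum>i\<in>UNIV. H x (axis i 1) $ i / ?W - (?p \<bullet> H x (axis i 1)) * ?p $ i / ?W ^ 3)"
      by (simp only:)
    also have "\<dots> = (\<Sum>i\<in>UNIV. H x (axis i 1) $ i) / ?W - ?p \<bullet> H x ?p / ?W ^ 3"
      using sum_linear_axis[OF lin', of ?p] by (simp add: sum_subtractf sum_divide_distrib[symmetric])
    finally have "(\<Sum>i\<in>UNIV. H x (axis i 1) $ i) / ?W * ?W ^ 3 = ?p \<bullet> H x ?p / ?W ^ 3 * ?W ^ 3" by simp
    then show ?thesis using W by (simp add: power2_eq_square power3_eq_cube mult_ac)
  qed
  show ?thesis by (rule that[OF dw dp cH nondiv])
qed

text \<open>The superlevel set is closed when taken in the closure of \<open>G\<close>, and positive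
  values exclude the frontier, so no point outside \<open>G\<close> is added.\<close>

lemma compact_superlevel_zero_frontier:
  fixes w :: "real^'n \<Rightarrow> real"
  assumes "continuous_on (closure G) w" "\<And>x. x \<in> frontier G \<Longrightarrow> w x = 0" "open G" "0 < \<epsilon>"
  shows "compact {x \<in> G. norm x \<le> R \<and> \<epsilon> \<le> w x}"
proof -
  have "closed (closure G \<inter> w -` {\<epsilon>..})"
    using assms(1) by (intro continuous_closed_preimage) auto
  then have "compact (cball 0 R \<inter> (closure G \<inter> w -` {\<epsilon>..}))"
    by (intro compact_Int_closed compact_cball)
  also have "cball 0 R \<inter> (closure G \<inter> w -` {\<epsilon>..}) = {x \<in> G. norm x \<le> R \<and> \<epsilon> \<le> w x}"
    using assms(2-4) closure_subset[of G] by (force simp: frontier_def interior_open)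
  finally show ?thesis .
qed

text \<open>The equation is odd in \<open>w\<close>, so a nonpositive solution may be replaced by
  its negative.\<close>

lemma admissible_imp_minimal_graph:
  fixes G :: "(real^'n) set"
  assumes "admissible G"
  obtains w p H where "minimal_graph G w p H" "\<exists>x\<in>G. 0 < w x"
proof -
  from assms obtain w where G: "open G" and w: "C2_on G w" "minimal_surface_eq_on G w"
    "continuous_on (closure G) w" "\<exists>x\<in>G. w x \<noteq> 0" and w0: "\<forall>x\<in>frontier G. w x = 0"
    and sign: "(\<forall>x\<in>G. 0 \<le> w x) \<or> (\<forall>x\<in>G. w x \<le> 0)"
    unfolding admissible_def by blast
  obtain p H where d: "\<And>x. x \<in> G \<Longrightarrow> (w has_derivative (\<lambda>h. p x \<bullet> h)) (at x)"
    "\<And>x. x \<in> G \<Longrightarrow> (p has_derivative H x) (at x)"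
    "\<And>i. continuous_on G (\<lambda>x. H x (axis i 1))"
    "\<And>x. x \<in> G \<Longrightarrow> (area_factor (p x))\<^sup>2 * (\<Sum>i\<in>UNIV. H x (axis i 1) $ i) = p x \<bullet> H x (p x)"
    by (rule C2_minimal_surface_derivatives[OF G w(1,2)]) (rule that)
  from sign show ?thesis
  proof
    assume nn: "\<forall>x\<in>G. 0 \<le> w x"
    have "minimal_graph G w p H"
      by unfold_locales (use G d nn compact_superlevel_zero_frontier[OF w(3) w0[rule_format] G] in auto)
    moreover have "\<exists>x\<in>G. 0 < w x" using w(4) nn by force
    ultimately show ?thesis by (rule that)
  next
    assume np: "\<forall>x\<in>G. w x \<le> 0"
    have "minimal_graph G (\<lambda>x. - w x) (\<lambda>x. - p x) (\<lambda>x h. - H x h)"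
    proof unfold_locales
      show "((\<lambda>x. - w x) has_derivative (\<lambda>h. - p x \<bullet> h)) (at x)" if "x \<in> G" for x
        using has_derivative_minus[OF d(1)[OF that]] by simp
      show "((\<lambda>x. - p x) has_derivative (\<lambda>h. - H x h)) (at x)" if "x \<in> G" for x
        using has_derivative_minus[OF d(2)[OF that]] .
      show "continuous_on G (\<lambda>x. - H x (axis i 1))" for i
        using d(3) by (intro continuous_intros)
      show "(area_factor (- p x))\<^sup>2 * (\<Sum>i\<in>UNIV. (- H x (axis i 1)) $ i) = - p x \<bullet> - H x (- p x)"
        if x: "x \<in> G" for x
      proof -
        have "H x (- p x) = - H x (p x)"
          using d(2)[OF x] has_derivative_linear linear_neg by blast
        then show ?thesis using d(4)[OF x] by (simp add: area_factor_def sum_negf)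
      qed
      show "compact {x \<in> G. norm x \<le> R \<and> \<epsilon> \<le> - w x}" if "0 < \<epsilon>" for \<epsilon> R
        using compact_superlevel_zero_frontier[of G "\<lambda>x. - w x", OF continuous_on_minus[OF w(3)] _ G that] w0 by simp
    qed (use G np in auto)
    moreover have "\<exists>x\<in>G. 0 < - w x" using w(4) np by force
    ultimately show ?thesis by (rule that)
  qed
qed

text \<open>\<open>M R\<close> is the integral of a truncated height over the part of the graph inside a
  cylinder of radius and height \<open>R\<close>, and \<open>A R\<close> is the area of that part.\<close>

lemma admissible_growth:
  fixes G :: "(real^'n) set"
  assumes "admissible G"
  obtains M A :: "real \<Rightarrow> real" and R0 where
    "\<And>R r. 0 < r \<Longrightarrow> M R * (unit_ball_vol (real CARD('n)) * r ^ CARD('n)) \<le> M (R + r) * A R"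
    "\<And>R. M R \<le> R * A R" "\<And>R. R0 \<le> R \<Longrightarrow> 0 < M R"
    "\<And>R R2 \<eta> \<eta>'. 0 < R \<Longrightarrow> R < R2 \<Longrightarrow> cutoff R R2 \<eta> \<eta>' \<Longrightarrow>
      A R \<le> (LINT x:G|lborel. indicator (cball 0 R) x + R2 * norm (\<eta>' x))"
proof -
  obtain w p H x0 where mg: "minimal_graph G w p H" and x0: "x0 \<in> G" "0 < w x0"
    using admissible_imp_minimal_graph[OF assms] by metis
  \<comment> \<open>A third, so that \<open>w x0\<close> exceeds twice the truncation level and
    \<open>F (w x0)\<close> is positive.\<close>
  have \<epsilon>: "0 < w x0 / 3" using x0 by simp
  obtain F F' F'' where F:
    "\<And>t. (F has_real_derivative F' t) (at t)" "\<And>t. (F' has_real_derivative F'' t) (at t)"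
    "continuous_on UNIV F''" "\<And>t. 0 \<le> F'' t" "\<And>t. 0 \<le> F' t" "\<And>t. 0 \<le> F t"
    "\<And>t. t \<le> w x0 / 3 \<Longrightarrow> F t = 0" "\<And>t. t \<le> w x0 / 3 \<Longrightarrow> F' t = 0"
    "\<And>t. 0 \<le> t \<Longrightarrow> F t \<le> t" "\<And>t. 2 * (w x0 / 3) < t \<Longrightarrow> 0 < F t"
    by (rule exists_convex_truncation[OF \<epsilon>]) (rule that)
  interpret minimal_graph G w p H by (rule mg)
  interpret truncated_minimal_graph G w p H "w x0 / 3" F F' F''
    by unfold_locales (use \<epsilon> F in auto)
  show ?thesis
  \<comment> \<open>From this radius on, \<open>x0\<close> lies in the cylinder of size
    \<open>R - 1\<close>, and the mean value inequality with radius 1 makes the mass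
    positive.\<close>
  proof (rule that[of mass area "max (norm x0) (w x0) + 1"])
    show "0 < mass R" if "max (norm x0) (w x0) + 1 \<le> R" for R
    proof -
      have "0 < F (w x0) * unit_ball_vol (real CARD('n))"
        using F(10)[of "w x0"] x0 by (intro mult_pos_pos) auto
      also have "\<dots> \<le> mass (R - 1 + 1)"
        using mean_value[of x0 "R - 1" 1] x0 that by simp
      finally show ?thesis by simp
    qed
  qed (use mass_growth mass_le_area area_le in blast)+
qed

text \<open>With one common cutoff, disjointness bounds the sum of the right-hand sides by an
  integral over the whole space. Letting \<open>R2\<close> decrease to \<open>R\<close> leaves the
  base plus the side of the cylinder.\<close>

lemma sum_area_le:
  fixes G :: "nat \<Rightarrow> (real^'n) set" and A :: "nat \<Rightarrow> real"
  assumes G: "\<And>k. k < s \<Longrightarrow> open (G k)"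
    and disj: "\<And>k l. k < s \<Longrightarrow> l < s \<Longrightarrow> k \<noteq> l \<Longrightarrow> G k \<inter> G l = {}"
    and A: "\<And>k R2 \<eta> \<eta>'. k < s \<Longrightarrow> R < R2 \<Longrightarrow> cutoff R R2 \<eta> \<eta>' \<Longrightarrow>
      A k \<le> (LINT x:G k|lborel. indicator (cball 0 R) x + R2 * norm (\<eta>' x))"
    and R: "0 < R"
  shows "(\<Sum>k<s. A k) \<le> (real CARD('n) + 1) * unit_ball_vol (real CARD('n)) * R ^ CARD('n)"
proof -
  let ?n = "CARD('n)" and ?\<omega> = "unit_ball_vol (real CARD('n))"
  have le: "(\<Sum>k<s. A k) \<le> ?\<omega> * R ^ ?n + R2 * (real ?n * (?\<omega> * R2 ^ ?n) / R)" if R2: "R < R2" for R2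
  proof -
    obtain \<eta> and \<eta>' :: "real^'n \<Rightarrow> real^'n" where cut: "cutoff R R2 \<eta> \<eta>'"
      and int: "R * (\<integral>x. norm (\<eta>' x) \<partial>lborel) \<le> real ?n * (?\<omega> * R2 ^ ?n)"
      using exists_cutoff[OF R R2] by metis
    let ?g = "\<lambda>x. indicator (cball 0 R) x + R2 * norm (\<eta>' x)"
    have i1: "integrable lborel (\<lambda>x. indicator (cball (0 :: real^'n) R) x :: real)"
      using borel_integrable_compact[of "cball (0 :: real^'n) R" "\<lambda>_. 1 :: real"] by simp
    have i2: "integrable lborel (\<lambda>x. norm (\<eta>' x))" using cutoff_integrable[OF cut] .
    have int_g: "integrable lborel ?g" using i1 i2 by simp
    have int_k: "integrable lborel (\<lambda>x. indicator (G k) x *\<^sub>R ?g x)" if "k < s" for k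
      using G[OF that] by (intro integrable_mult_indicator int_g) simp
    have "(\<Sum>k<s. A k) \<le> (\<Sum>k<s. \<integral>x. indicator (G k) x *\<^sub>R ?g x \<partial>lborel)"
      using A[OF _ R2 cut] by (intro sum_mono) (auto simp: set_lebesgue_integral_def)
    also have "\<dots> = (\<integral>x. (\<Sum>k<s. indicator (G k) x *\<^sub>R ?g x) \<partial>lborel)"
      using int_k by (intro Bochner_Integration.integral_sum[symmetric]) auto
    also have "\<dots> \<le> (\<integral>x. ?g x \<partial>lborel)"
    proof (rule integral_mono)
      show "integrable lborel (\<lambda>x. \<Sum>k<s. indicator (G k) x *\<^sub>R ?g x)"
        using int_k by (intro Bochner_Integration.integrable_sum) auto
      fix x :: "real^'n"
      have "(\<Sum>k<s. indicator (G k) x :: real) = indicator (\<Union>k<s. G k) x"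
        using disj by (intro indicator_UN_disjoint[symmetric]) (auto simp: disjoint_family_on_def)
      also have "\<dots> \<le> 1" by (simp add: indicator_def)
      finally have "(\<Sum>k<s. indicator (G k) x) * ?g x \<le> 1 * ?g x"
        using R R2 by (intro mult_right_mono) auto
      then show "(\<Sum>k<s. indicator (G k) x *\<^sub>R ?g x) \<le> ?g x"
        by (simp add: sum_distrib_right)
    qed (rule int_g)
    also have "\<dots> = measure lborel (cball (0 :: real^'n) R) + R2 * (\<integral>x. norm (\<eta>' x) \<partial>lborel)"
      using i1 i2 by simp
    also have "\<dots> \<le> ?\<omega> * R ^ ?n + R2 * (real ?n * (?\<omega> * R2 ^ ?n) / R)"
      using content_cball[of R "0 :: real^'n"] int R R2
      by (intro add_mono mult_left_mono) (auto simp: pos_le_divide_eq mult.commute)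
    finally show ?thesis .
  qed
  have "((\<lambda>R2. ?\<omega> * R ^ ?n + R2 * (real ?n * (?\<omega> * R2 ^ ?n) / R)) \<longlongrightarrow>
      ?\<omega> * R ^ ?n + R * (real ?n * (?\<omega> * R ^ ?n) / R)) (at_right R)"
    using R by (intro tendsto_intros) auto
  then have "(\<Sum>k<s. A k) \<le> ?\<omega> * R ^ ?n + R * (real ?n * (?\<omega> * R ^ ?n) / R)"
    by (rule tendsto_lowerbound) (use le in \<open>auto simp: eventually_at_right_field intro!: exI[of _ "R + 1"]\<close>)
  then show ?thesis using R by (simp add: algebra_simps)
qed

section \<open>Counting\<close>

lemma prod_le_power_mean:
  fixes a :: "nat \<Rightarrow> real"
  assumes "0 < s" "\<And>k. k < s \<Longrightarrow> 0 \<le> a k" "(\<Sum>k<s. a k) \<le> c"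
  shows "(\<Prod>k<s. a k) \<le> (c / real s) ^ s"
proof (cases "(\<Prod>k<s. a k) = 0")
  case True
  have "0 \<le> (\<Sum>k<s. a k)" using assms(2) by (intro sum_nonneg) auto
  then have "0 \<le> (c / real s) ^ s" using assms(3) by simp
  with True show ?thesis by linarith
next
  case False
  have nn: "0 \<le> (\<Prod>k<s. a k)" using assms(2) by (intro prod_nonneg) auto
  with False have pos: "0 < (\<Prod>k<s. a k)" by linarith
  have root_pow: "(P powr (1 / real s)) ^ s = P" if "0 < P" for P
    using powr_realpow[of "P powr (1 / real s)" s] that assms(1) by (simp add: powr_powr)
  have "(\<Prod>k<s. a k) powr (1 / real s) \<le> (\<Sum>k<s. a k / real s)"
    using arith_geom_mean[of "{..<s}" a] assms(1,2) by auto
  also have "\<dots> \<le> c / real s"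
    using assms(1,3) by (simp add: sum_divide_distrib[symmetric] divide_right_mono)
  finally have "((\<Prod>k<s. a k) powr (1 / real s)) ^ s \<le> (c / real s) ^ s"
    by (intro power_mono) auto
  also have "((\<Prod>k<s. a k) powr (1 / real s)) ^ s = (\<Prod>k<s. a k)"
    by (rule root_pow[OF pos])
  finally show ?thesis .
qed

text \<open>By AM-GM the product of the \<open>M k\<close> grows by at least the factor \<open>(s / c) ^ s\<close> when \<open>R\<close> is
  multiplied by \<open>\<beta>\<close>, whereas its growth is at most that of \<open>R ^ (d * s)\<close>.\<close>

lemma card_le_of_growth:
  fixes M :: "nat \<Rightarrow> real \<Rightarrow> real" and c \<beta> B \<rho> :: real and d s :: nat
  assumes \<beta>: "1 < \<beta>" and \<rho>: "0 < \<rho>" and c: "0 < c"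
    and pos: "\<And>k R. k < s \<Longrightarrow> \<rho> \<le> R \<Longrightarrow> 0 < M k R"
    and le: "\<And>k R. k < s \<Longrightarrow> \<rho> \<le> R \<Longrightarrow> M k R \<le> B * R ^ d"
    and ratio: "\<And>R. \<rho> \<le> R \<Longrightarrow> (\<Sum>k<s. M k R / M k (\<beta> * R)) \<le> c"
  shows "real s \<le> c * \<beta> ^ d"
proof (rule ccontr)
  assume "\<not> real s \<le> c * \<beta> ^ d"
  then have lt: "c * \<beta> ^ d < real s" by simp
  have cb: "0 < c * \<beta> ^ d" using c \<beta> by simp
  then have s: "0 < s" using lt by (cases s) auto
  define T where "T m = (\<Prod>k<s. M k (\<beta> ^ m * \<rho>))" for m
  have R: "\<rho> \<le> \<beta> ^ m * \<rho>" for m using \<beta> \<rho> by (simp add: one_le_power)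
  have T_pos: "0 < T m" for m unfolding T_def using pos R by (intro prod_pos) auto
  have step: "T m \<le> (c / real s) ^ s * T (Suc m)" for m
  proof -
    have "T m / T (Suc m) = (\<Prod>k<s. M k (\<beta> ^ m * \<rho>) / M k (\<beta> * (\<beta> ^ m * \<rho>)))"
      by (simp add: T_def prod_dividef mult.assoc)
    also have "\<dots> \<le> (c / real s) ^ s"
      using pos R[of m] R[of "Suc m"] by (intro prod_le_power_mean s ratio[OF R]) (auto simp: mult.assoc less_imp_le)
    finally show ?thesis using T_pos[of "Suc m"] by (simp add: pos_divide_le_eq)
  qed
  have iter: "T 0 \<le> ((c / real s) ^ s) ^ m * T m" for m
  proof (induction m)
    case (Suc m)
    have "((c / real s) ^ s) ^ m * T m \<le> ((c / real s) ^ s) ^ m * ((c / real s) ^ s * T (Suc m))"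
      using step c by (intro mult_left_mono) auto
    with Suc show ?case by (simp add: mult_ac)
  qed simp
  have T_le: "T m \<le> (B * \<rho> ^ d) ^ s * ((\<beta> ^ d) ^ s) ^ m" for m
  proof -
    have "T m \<le> (\<Prod>k<s. B * (\<beta> ^ m * \<rho>) ^ d)"
      unfolding T_def using le pos R[of m] by (intro prod_mono) (auto simp: less_imp_le)
    also have "\<dots> = (B * \<rho> ^ d) ^ s * ((\<beta> ^ d) ^ s) ^ m"
      by (simp add: power_mult_distrib power_mult[symmetric] mult_ac)
    finally show ?thesis .
  qed
  \<comment> \<open>The AM-GM factor times the admissible growth, for one multiplication of the
    radius by \<beta>. If the claim fails it is below 1, and iterating forces the positive number
    \<open>T 0\<close> to be at most 0.\<close>
  let ?\<theta> = "(c * \<beta> ^ d / real s) ^ s"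
  have "T 0 \<le> (B * \<rho> ^ d) ^ s * ?\<theta> ^ m" for m
  proof -
    have "T 0 \<le> ((c / real s) ^ s) ^ m * T m" by (rule iter)
    also have "\<dots> \<le> ((c / real s) ^ s) ^ m * ((B * \<rho> ^ d) ^ s * ((\<beta> ^ d) ^ s) ^ m)"
      using T_le c by (intro mult_left_mono) auto
    also have "\<dots> = (B * \<rho> ^ d) ^ s * ?\<theta> ^ m"
      by (simp add: power_mult_distrib power_divide mult_ac)
    finally show ?thesis .
  qed
  moreover have "(\<lambda>m. (B * \<rho> ^ d) ^ s * ?\<theta> ^ m) \<longlonglongrightarrow> (B * \<rho> ^ d) ^ s * 0"
  proof (intro tendsto_mult tendsto_const LIMSEQ_realpow_zero)
    show "0 \<le> ?\<theta>" using cb by simp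
    have "0 \<le> c * \<beta> ^ d / real s" "c * \<beta> ^ d / real s < 1" using lt cb s by auto
    then show "?\<theta> < 1" using s by (simp add: power_less_one_iff)
  qed
  ultimately have "T 0 \<le> (B * \<rho> ^ d) ^ s * 0" by (intro LIMSEQ_le_const) auto
  then show False using T_pos[of 0] by simp
qed

theorem theorem1:
  fixes G :: "nat \<Rightarrow> (real^'n) set" and s :: nat
  assumes "CARD('n) \<ge> 3"
    and "\<forall>k<s. admissible (G k)"
    and "\<forall>k<s. \<forall>l<s. k \<noteq> l \<longrightarrow> G k \<inter> G l = {}"
  shows "real s \<le> exp 1 * (real CARD('n) + 1)\<^sup>2"
proof -
  let ?n = "CARD('n)" and ?\<omega> = "unit_ball_vol (real CARD('n))"
  have n: "0 < real ?n" by simp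
  have \<omega>: "0 < ?\<omega>" by simp
  \<comment> \<open>Bundling the growth properties lets a single application of choice produce mass,
    area and starting radius for all the domains at once.\<close>
  define P where "P k M A R0 \<longleftrightarrow>
      (\<forall>R r. 0 < r \<longrightarrow> M R * (?\<omega> * r ^ ?n) \<le> M (R + r) * A R) \<and>
      (\<forall>R. M R \<le> R * A R) \<and> (\<forall>R\<ge>R0. 0 < M R) \<and>
      (\<forall>R R2 \<eta> \<eta>'. 0 < R \<longrightarrow> R < R2 \<longrightarrow> cutoff R R2 \<eta> \<eta>' \<longrightarrow>
        A R \<le> (LINT x:G k|lborel. indicator (cball 0 R) x + R2 * norm (\<eta>' x)))"
    for k and M A :: "real \<Rightarrow> real" and R0 :: real
  have "\<exists>M A R0. k < s \<longrightarrow> P k M A R0" for k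
  proof (cases "k < s")
    case True
    then have "admissible (G k)" using assms(2) by blast
    then show ?thesis unfolding P_def by (rule admissible_growth) blast
  qed simp
  then obtain M A R0 where P: "\<And>k. k < s \<Longrightarrow> P k (M k) (A k) (R0 k)" by metis
  have growth: "\<And>k R r. k < s \<Longrightarrow> 0 < r \<Longrightarrow> M k R * (?\<omega> * r ^ ?n) \<le> M k (R + r) * A k R"
    and M_le: "\<And>k R. k < s \<Longrightarrow> M k R \<le> R * A k R"
    and M_pos: "\<And>k R. k < s \<Longrightarrow> R0 k \<le> R \<Longrightarrow> 0 < M k R"
    and A_le: "\<And>k R R2 \<eta> \<eta>'. k < s \<Longrightarrow> 0 < R \<Longrightarrow> R < R2 \<Longrightarrow> cutoff R R2 \<eta> \<eta>' \<Longrightarrow>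
        A k R \<le> (LINT x:G k|lborel. indicator (cball 0 R) x + R2 * norm (\<eta>' x))"
    using P unfolding P_def by blast+
  \<comment> \<open>A common radius beyond which all masses are positive. The element 1 keeps it
    positive and the set nonempty when \<open>s = 0\<close>.\<close>
  define R1 where "R1 = Max (insert 1 (R0 ` {..<s}))"
  have R1: "1 \<le> R1" "\<And>k. k < s \<Longrightarrow> R0 k \<le> R1" unfolding R1_def by auto
  define C where "C = (real ?n + 1) * ?\<omega>"
  have sum_A: "(\<Sum>k<s. A k R) \<le> C * R ^ ?n" if "0 < R" for R
    unfolding C_def
  proof (rule sum_area_le[where G = G])
    show "open (G k)" if "k < s" for k using assms(2) that by (simp add: admissible_def)
    show "G k \<inter> G l = {}" if "k < s" "l < s" "k \<noteq> l" for k l using assms(3) that by blast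
  qed (use A_le that in blast)+
  have A_pos: "0 < A k R" if "k < s" "R1 \<le> R" for k R
  proof -
    have "0 < M k R" using M_pos R1(2) that by (meson order_trans)
    then have "0 < R * A k R" using M_le[OF that(1), of R] by linarith
    then show ?thesis using R1(1) that(2) by (simp add: zero_less_mult_iff)
  qed
  have A1: "A k R \<le> C * R ^ ?n" if k: "k < s" and R: "R1 \<le> R" for k R
  proof -
    have "A k R \<le> (\<Sum>k<s. A k R)"
      using k R A_pos by (intro member_le_sum) (auto simp: less_imp_le)
    also have "\<dots> \<le> C * R ^ ?n" using sum_A R R1(1) by simp
    finally show ?thesis .
  qed
  \<comment> \<open>The growth exponent is one more than that of the area, because the height
    contributes a further factor \<open>R\<close> to the mass.\<close>
  have "real s \<le> ((real ?n + 1) / real ?n ^ ?n) * (real ?n + 1) ^ Suc ?n"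
  proof (rule card_le_of_growth[where M = M and \<rho> = R1 and B = C])
    show "1 < real ?n + 1" "0 < R1" "0 < (real ?n + 1) / real ?n ^ ?n" using R1(1) n by auto
    show "0 < M k R" if "k < s" "R1 \<le> R" for k R using M_pos R1(2) that by (meson order_trans)
    show "M k R \<le> C * R ^ Suc ?n" if "k < s" "R1 \<le> R" for k R
    proof -
      have "M k R \<le> R * A k R" by (rule M_le[OF that(1)])
      also have "\<dots> \<le> R * (C * R ^ ?n)" using A1[OF that] that R1(1) by (intro mult_left_mono) auto
      finally show ?thesis by (simp add: mult_ac)
    qed
    show "(\<Sum>k<s. M k R / M k ((real ?n + 1) * R)) \<le> (real ?n + 1) / real ?n ^ ?n" if R: "R1 \<le> R" for R
    proof -
      have R_pos: "0 < R" using R R1(1) by linarith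
      let ?D = "?\<omega> * (real ?n * R) ^ ?n"
      have D: "0 < ?D" using \<omega> n R_pos by simp
      have "M k R / M k ((real ?n + 1) * R) \<le> A k R / ?D" if k: "k < s" for k
      proof -
        have eq: "R + real ?n * R = (real ?n + 1) * R" by (simp add: algebra_simps)
        have "R1 \<le> (real ?n + 1) * R" using R R_pos n eq by (metis add_increasing2 less_imp_le mult_pos_pos)
        then have "0 < M k ((real ?n + 1) * R)" using M_pos R1(2) k by (meson order_trans)
        moreover have "M k R * ?D \<le> M k ((real ?n + 1) * R) * A k R"
          using growth[OF k, of "real ?n * R" R] n R_pos unfolding eq by simp
        ultimately show ?thesis using D by (simp add: divide_simps mult_ac)
      qed
      then have "(\<Sum>k<s. M k R / M k ((real ?n + 1) * R)) \<le> (\<Sum>k<s. A k R / ?D)"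
        by (intro sum_mono) auto
      also have "\<dots> = (\<Sum>k<s. A k R) / ?D" by (simp add: sum_divide_distrib)
      also have "\<dots> \<le> C * R ^ ?n / ?D" using sum_A[OF R_pos] D by (intro divide_right_mono) auto
      also have "\<dots> = (real ?n + 1) / real ?n ^ ?n"
        using less_imp_neq[OF \<omega>] R_pos n by (simp add: C_def power_mult_distrib)
      finally show ?thesis .
    qed
  qed
  also have "\<dots> = (1 + 1 / real ?n) ^ ?n * (real ?n + 1)\<^sup>2"
  proof -
    have "(1 + 1 / real ?n) ^ ?n = (real ?n + 1) ^ ?n / real ?n ^ ?n"
      using n by (simp add: power_divide[symmetric] add_divide_distrib add.commute)
    then show ?thesis by (simp add: power2_eq_square)
  qed
  also have "\<dots> \<le> exp 1 * (real ?n + 1)\<^sup>2"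
  proof (rule mult_right_mono)
    have "(1 + 1 / real ?n) ^ ?n \<le> exp (1 / real ?n) ^ ?n"
      by (intro power_mono exp_ge_add_one_self) simp
    also have "\<dots> = exp 1" using n by (simp add: exp_of_nat_mult[symmetric])
    finally show "(1 + 1 / real ?n) ^ ?n \<le> exp 1" .
  qed simp
  finally show ?thesis .
qed

end
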